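(* Let $G_t$ ($t=0,\dots,T$) be proper convex lower semicontinuous functions on $C_t$ and let $H$ be a proper convex lower semicontinuous function on $C$. Assume that the set \[ \bigcup_{\alpha>0}\alpha\operatorname{dom}\varphi \] is a nonempty closed linear subspace of $C$. Then the optimum in problem (DR) is attained, there is no duality gap (that is, $\inf(\mathrm{P})=-\inf(\mathrm{DR})$), and an $x=(x_t)_{t=0}^T\in\prod_{t=0}^TC_t$ solves (P) if and only if there is a $\lambda\in C^*$ such that \begin{align*} \partial G_t(x_t)&\ni\lambda_t,\quad t=0,\dots,T,\\ \partial H\Big(-\sum_{t=0}^Tx_t\circ\pi_t\Big)&\ni\lambda, \end{align*} and then $\lambda$ solves (DR).
   Context: $S_0,\dots,S_T$ are Polish spaces, $S=S_0\times\cdots\times S_T$, $\pi_t:S\to S_t$ is $\pi_t(s)=s_t$, and $d\ge1$ is an integer. For each $t$, $\psi_t:S_t\to[1,\infty)$ is a given continuous function and $\psi(s):=\sum_{t=0}^T\psi_t(s_t)$. The Banach spaces \[ C_t:=\{x_t\in C(S_t;\mathbb R^d)\mid x_t/\psi_t\in C_b(S_t;\mathbb R^d)\},\qquad C:=\{u\in C(S;\mathbb R^d)\mid u/\psi\in C_b(S;\mathbb R^d)\} \] have norms $\|x_t\|_{C_t}=\|x_t/\psi_t\|_{C_b}$ and $\|u\|_C=\|u/\psi\|_{C_b}$ (supremum norms of the scaled functions). $C_t^*$ and $C^*$ are their topological duals, with pairing $\langle u,\lambda\rangle=\lambda(u)$. For $\lambda\in C^*$, its $t$-th marginal $\lambda_t\in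 C_t^*$ is $\langle x_t,\lambda_t\rangle:=\langle x_t\circ\pi_t,\lambda\rangle$. Problem (P): minimize $\sum_{t=0}^TG_t(x_t)+H\big(-\sum_{t=0}^Tx_t\circ\pi_t\big)$ over $x\in\prod_{t=0}^TC_t$. The optimum value function on $C$ is $\varphi(u):=\inf_x\big\{\sum_{t=0}^TG_t(x_t)+H\big(u-\sum_{t=0}^Tx_t\circ\pi_t\big)\big\}$, and $\operatorname{dom}\varphi=\{u\mid\varphi(u)<\infty\}=\operatorname{dom}H+\{\sum_{t=0}^Tx_t\circ\pi_t\mid x_t\in\operatorname{dom}G_t\}$. Problem (DR): minimize $\sum_{t=0}^TG_t^*(\lambda_t)+H^*(\lambda)$ over $\lambda\in C^*$, where $G_t^*$ and $H^*$ are the convex conjugates of $G_t$ and $H$ on $C_t^*$ and $C^*$. $\partial$ denotes the convex subdifferential. "Attained" means that some $\lambda\in C^*$ has objective value equal to the infimum. *)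

theory Defs
  imports "HOL-Analysis.Analysis"
begin

section \<open>Weighted spaces of continuous functions\<close>

text \<open>
  The factors \<open>S\<^sub>t\<close> are different spaces, so they are abstract topologies on a common type
  rather than types. The type is arbitrary, so this is no restriction: finitely many spaces
  can always be placed in the disjoint sum of their types.
\<close>

definition polish_topology :: "'p topology \<Rightarrow> bool" where
  "polish_topology X \<longleftrightarrow> completely_metrizable_space X \<and> second_countable X"

text \<open>
  A function on \<^term>\<open>topspace X\<close> is represented by the total function that is 0 outside
  \<^term>\<open>topspace X\<close>; hence equality in HOL is equality of functions on \<^term>\<open>topspace X\<close>.
\<close>

definition cont_space :: "'p topology \<Rightarrow> ('p \<Rightarrow> real^'d) set" where
  "cont_space X = {x. continuous_map X euclidean x \<and> (\<forall>s. s \<notin> topspace X \<longrightarrow> x s = 0)}"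

definition bcont_space :: "'p topology \<Rightarrow> ('p \<Rightarrow> real^'d) set" where
  "bcont_space X = {x \<in> cont_space X. bounded (x ` topspace X)}"

text \<open>Inserting 0 only makes the supremum the correct one when \<^term>\<open>topspace X\<close> is empty.\<close>

definition sup_norm :: "'p topology \<Rightarrow> ('p \<Rightarrow> real^'d) \<Rightarrow> real" where
  "sup_norm X x = Sup (insert 0 ((\<lambda>s. norm (x s)) ` topspace X))"

definition weighted_space :: "'p topology \<Rightarrow> ('p \<Rightarrow> real) \<Rightarrow> ('p \<Rightarrow> real^'d) set" where
  "weighted_space X \<psi> = {x \<in> cont_space X. (\<lambda>s. x s /\<^sub>R \<psi> s) \<in> bcont_space X}"

definition weighted_norm :: "'p topology \<Rightarrow> ('p \<Rightarrow> real) \<Rightarrow> ('p \<Rightarrow> real^'d) \<Rightarrow> real" where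
  "weighted_norm X \<psi> x = sup_norm X (\<lambda>s. x s /\<^sub>R \<psi> s)"

text \<open>
  The value 0 outside the carrier is there because the axioms of the locale
  \<^locale>\<open>Metric_space\<close> for nonnegativity and symmetry are not relativised.
\<close>

definition weighted_dist ::
    "'p topology \<Rightarrow> ('p \<Rightarrow> real) \<Rightarrow> ('p \<Rightarrow> real^'d) \<Rightarrow> ('p \<Rightarrow> real^'d) \<Rightarrow> real" where
  "weighted_dist X \<psi> x y =
     (if x \<in> weighted_space X \<psi> \<and> y \<in> weighted_space X \<psi>
      then weighted_norm X \<psi> (\<lambda>s. x s - y s) else 0)"

definition weighted_topology :: "'p topology \<Rightarrow> ('p \<Rightarrow> real) \<Rightarrow> ('p \<Rightarrow> real^'d) topology" where
  "weighted_topology X \<psi> = Metric_space.mtopology (weighted_space X \<psi>) (weighted_dist X \<psi>)"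

lemma weighted_space_bound:
  assumes "x \<in> weighted_space X \<psi>"
  obtains B where "\<And>s. s \<in> topspace X \<Longrightarrow> norm (x s /\<^sub>R \<psi> s) \<le> B"
  using assms unfolding weighted_space_def bcont_space_def bounded_iff by blast

lemma weighted_dist_upper:
  assumes x: "x \<in> weighted_space X \<psi>" and y: "y \<in> weighted_space X \<psi>" and s: "s \<in> topspace X"
  shows "norm ((x s - y s) /\<^sub>R \<psi> s) \<le> weighted_dist X \<psi> x y"
proof -
  obtain B where B: "\<And>s. s \<in> topspace X \<Longrightarrow> norm (x s /\<^sub>R \<psi> s) \<le> B"
    using weighted_space_bound[OF x] by blast
  obtain B' where B': "\<And>s. s \<in> topspace X \<Longrightarrow> norm (y s /\<^sub>R \<psi> s) \<le> B'"
    using weighted_space_bound[OF y] by blast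
  have "norm ((x s - y s) /\<^sub>R \<psi> s) \<le> B + B'" if "s \<in> topspace X" for s
    using norm_triangle_ineq4[of "x s /\<^sub>R \<psi> s" "y s /\<^sub>R \<psi> s"] B[OF that] B'[OF that]
    by (simp add: scaleR_right_diff_distrib)
  then have "bdd_above (insert 0 ((\<lambda>s. norm ((x s - y s) /\<^sub>R \<psi> s)) ` topspace X))"
    unfolding bdd_above_insert by (rule bdd_aboveI2)
  then show ?thesis
    using x y s unfolding weighted_dist_def weighted_norm_def sup_norm_def
    by (auto intro!: cSup_upper)
qed

lemma weighted_dist_least:
  assumes "0 \<le> r" and "\<And>s. s \<in> topspace X \<Longrightarrow> norm ((x s - y s) /\<^sub>R \<psi> s) \<le> r"
  shows "weighted_dist X \<psi> x y \<le> r"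
  using assms unfolding weighted_dist_def weighted_norm_def sup_norm_def
  by (auto intro!: cSup_least)

lemma weighted_dist_nonneg: "0 \<le> weighted_dist X \<psi> x y"
proof (cases "x \<in> weighted_space X \<psi> \<and> y \<in> weighted_space X \<psi>")
  case True
  show ?thesis
  proof (cases "topspace X = {}")
    case True
    then show ?thesis by (simp add: weighted_dist_def weighted_norm_def sup_norm_def)
  next
    case False
    then obtain s where "s \<in> topspace X" by blast
    then show ?thesis
      using weighted_dist_upper[of x X \<psi> y s] \<open>x \<in> _ \<and> y \<in> _\<close>
      by (meson norm_ge_zero order_trans)
  qed
qed (simp only: weighted_dist_def if_False order_refl)

lemma Metric_space_weighted:
  assumes pos: "\<And>s. s \<in> topspace X \<Longrightarrow> 0 < \<psi> s"
  shows "Metric_space (weighted_space X \<psi>) (weighted_dist X \<psi>)"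
proof
  fix x y :: "'a \<Rightarrow> real^'b"
  show "0 \<le> weighted_dist X \<psi> x y" by (rule weighted_dist_nonneg)
  show "weighted_dist X \<psi> x y = weighted_dist X \<psi> y x"
    by (simp add: weighted_dist_def weighted_norm_def sup_norm_def norm_minus_commute)
next
  fix x y :: "'a \<Rightarrow> real^'b"
  assume xy: "x \<in> weighted_space X \<psi>" "y \<in> weighted_space X \<psi>"
  show "weighted_dist X \<psi> x y = 0 \<longleftrightarrow> x = y"
  proof
    assume 0: "weighted_dist X \<psi> x y = 0"
    show "x = y"
    proof
      fix s
      show "x s = y s"
      proof (cases "s \<in> topspace X")
        case True
        then show ?thesis using weighted_dist_upper[OF xy True] pos[OF True] 0
          by (auto simp: mult_le_0_iff)
      next
        case False
        then show ?thesis using xy by (simp add: weighted_space_def cont_space_def)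
      qed
    qed
  next
    assume "x = y"
    then show "weighted_dist X \<psi> x y = 0"
      using weighted_dist_least[where r = 0 and X = X and x = x and y = y and \<psi> = \<psi>] weighted_dist_nonneg[of X \<psi> x y] by simp
  qed
next
  fix x y z :: "'a \<Rightarrow> real^'b"
  assume x: "x \<in> weighted_space X \<psi>" and y: "y \<in> weighted_space X \<psi>"
    and z: "z \<in> weighted_space X \<psi>"
  show "weighted_dist X \<psi> x z \<le> weighted_dist X \<psi> x y + weighted_dist X \<psi> y z"
  proof (rule weighted_dist_least)
    show "0 \<le> weighted_dist X \<psi> x y + weighted_dist X \<psi> y z"
      by (simp add: weighted_dist_nonneg)
    fix s assume s: "s \<in> topspace X"
    have "norm ((x s - z s) /\<^sub>R \<psi> s) =
        norm ((x s - y s) /\<^sub>R \<psi> s + (y s - z s) /\<^sub>R \<psi> s)"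
      by (simp only: scaleR_right_distrib[symmetric]) simp
    also have "\<dots> \<le> norm ((x s - y s) /\<^sub>R \<psi> s) + norm ((y s - z s) /\<^sub>R \<psi> s)"
      by (rule norm_triangle_ineq)
    also have "\<dots> \<le> weighted_dist X \<psi> x y + weighted_dist X \<psi> y z"
      by (intro add_mono weighted_dist_upper x y z s)
    finally show "norm ((x s - z s) /\<^sub>R \<psi> s) \<le>
        weighted_dist X \<psi> x y + weighted_dist X \<psi> y z" .
  qed
qed

text \<open>
  Dual elements are constrained only on the carrier, and all notions below use only their values
  there; two HOL functions that agree on the carrier represent the same functional.
\<close>

definition weighted_dual ::
    "'p topology \<Rightarrow> ('p \<Rightarrow> real) \<Rightarrow> (('p \<Rightarrow> real^'d) \<Rightarrow> real) set" where
  "weighted_dual X \<psi> = {l.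
     (\<forall>x\<in>weighted_space X \<psi>. \<forall>y\<in>weighted_space X \<psi>. l (\<lambda>s. x s + y s) = l x + l y) \<and>
     (\<forall>x\<in>weighted_space X \<psi>. \<forall>a. l (\<lambda>s. a *\<^sub>R x s) = a * l x) \<and>
     continuous_map (weighted_topology X \<psi>) euclideanreal l}"

definition closed_linear_subspace ::
    "'p topology \<Rightarrow> ('p \<Rightarrow> real) \<Rightarrow> ('p \<Rightarrow> real^'d) set \<Rightarrow> bool" where
  "closed_linear_subspace X \<psi> A \<longleftrightarrow>
     A \<noteq> {} \<and>
     (\<forall>x\<in>A. \<forall>y\<in>A. (\<lambda>s. x s + y s) \<in> A) \<and>
     (\<forall>x\<in>A. \<forall>a. (\<lambda>s. a *\<^sub>R x s) \<in> A) \<and>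
     closedin (weighted_topology X \<psi>) A"

section \<open>Convex analysis on a weighted space\<close>

definition proper_fun ::
    "'p topology \<Rightarrow> ('p \<Rightarrow> real) \<Rightarrow> (('p \<Rightarrow> real^'d) \<Rightarrow> ereal) \<Rightarrow> bool" where
  "proper_fun X \<psi> f \<longleftrightarrow>
     (\<forall>x\<in>weighted_space X \<psi>. f x > -\<infinity>) \<and> (\<exists>x\<in>weighted_space X \<psi>. f x < \<infinity>)"

definition convex_fun ::
    "'p topology \<Rightarrow> ('p \<Rightarrow> real) \<Rightarrow> (('p \<Rightarrow> real^'d) \<Rightarrow> ereal) \<Rightarrow> bool" where
  "convex_fun X \<psi> f \<longleftrightarrow>
     (\<forall>x\<in>weighted_space X \<psi>. \<forall>y\<in>weighted_space X \<psi>. \<forall>a. 0 < a \<and> a < 1 \<longrightarrow>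
        f (\<lambda>s. a *\<^sub>R x s + (1 - a) *\<^sub>R y s) \<le> ereal a * f x + ereal (1 - a) * f y)"

definition lsc_fun ::
    "'p topology \<Rightarrow> ('p \<Rightarrow> real) \<Rightarrow> (('p \<Rightarrow> real^'d) \<Rightarrow> ereal) \<Rightarrow> bool" where
  "lsc_fun X \<psi> f \<longleftrightarrow>
     (\<forall>r::ereal. closedin (weighted_topology X \<psi>) {x \<in> weighted_space X \<psi>. f x \<le> r})"

definition conjugate ::
    "'p topology \<Rightarrow> ('p \<Rightarrow> real) \<Rightarrow> (('p \<Rightarrow> real^'d) \<Rightarrow> ereal) \<Rightarrow>
     (('p \<Rightarrow> real^'d) \<Rightarrow> real) \<Rightarrow> ereal" where
  "conjugate X \<psi> f l = (SUP x\<in>weighted_space X \<psi>. ereal (l x) - f x)"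

text \<open>For proper \<open>f\<close> this set is empty whenever \<^prop>\<open>f x = \<infinity>\<close>.\<close>

definition subdifferential ::
    "'p topology \<Rightarrow> ('p \<Rightarrow> real) \<Rightarrow> (('p \<Rightarrow> real^'d) \<Rightarrow> ereal) \<Rightarrow>
     ('p \<Rightarrow> real^'d) \<Rightarrow> (('p \<Rightarrow> real^'d) \<Rightarrow> real) set" where
  "subdifferential X \<psi> f x = {l \<in> weighted_dual X \<psi>.
     \<forall>y\<in>weighted_space X \<psi>. f y \<ge> f x + ereal (l (\<lambda>s. y s - x s))}"

section \<open>The primal and dual problems\<close>

abbreviation path_top :: "nat \<Rightarrow> (nat \<Rightarrow> 'a topology) \<Rightarrow> (nat \<Rightarrow> 'a) topology" where
  "path_top T X \<equiv> product_topology X {..T}"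

definition path_weight :: "nat \<Rightarrow> (nat \<Rightarrow> 'a \<Rightarrow> real) \<Rightarrow> (nat \<Rightarrow> 'a) \<Rightarrow> real" where
  "path_weight T \<psi> s = (\<Sum>t\<le>T. \<psi> t (s t))"

text \<open>\<open>x\<^sub>t \<circ> \<pi>\<^sub>t\<close>, again 0 outside the domain.\<close>

definition comp_proj ::
    "nat \<Rightarrow> (nat \<Rightarrow> 'a topology) \<Rightarrow> nat \<Rightarrow> ('a \<Rightarrow> real^'d) \<Rightarrow> (nat \<Rightarrow> 'a) \<Rightarrow> real^'d" where
  "comp_proj T X t x s = (if s \<in> topspace (path_top T X) then x (s t) else 0)"

definition marginal ::
    "nat \<Rightarrow> (nat \<Rightarrow> 'a topology) \<Rightarrow> nat \<Rightarrow> (((nat \<Rightarrow> 'a) \<Rightarrow> real^'d) \<Rightarrow> real) \<Rightarrow>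
     ('a \<Rightarrow> real^'d) \<Rightarrow> real" where
  "marginal T X t l x = l (comp_proj T X t x)"

definition prod_space ::
    "nat \<Rightarrow> (nat \<Rightarrow> 'a topology) \<Rightarrow> (nat \<Rightarrow> 'a \<Rightarrow> real) \<Rightarrow> (nat \<Rightarrow> 'a \<Rightarrow> real^'d) set" where
  "prod_space T X \<psi> = (\<Pi>\<^sub>E t\<in>{..T}. weighted_space (X t) (\<psi> t))"

definition primal_obj ::
    "nat \<Rightarrow> (nat \<Rightarrow> 'a topology) \<Rightarrow> (nat \<Rightarrow> ('a \<Rightarrow> real^'d) \<Rightarrow> ereal) \<Rightarrow>
     (((nat \<Rightarrow> 'a) \<Rightarrow> real^'d) \<Rightarrow> ereal) \<Rightarrow> (nat \<Rightarrow> 'a \<Rightarrow> real^'d) \<Rightarrow> ereal" where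
  "primal_obj T X G H x =
     (\<Sum>t\<le>T. G t (x t)) + H (\<lambda>s. - (\<Sum>t\<le>T. comp_proj T X t (x t) s))"

definition primal_inf ::
    "nat \<Rightarrow> (nat \<Rightarrow> 'a topology) \<Rightarrow> (nat \<Rightarrow> 'a \<Rightarrow> real) \<Rightarrow>
     (nat \<Rightarrow> ('a \<Rightarrow> real^'d) \<Rightarrow> ereal) \<Rightarrow> (((nat \<Rightarrow> 'a) \<Rightarrow> real^'d) \<Rightarrow> ereal) \<Rightarrow> ereal" where
  "primal_inf T X \<psi> G H = (INF x\<in>prod_space T X \<psi>. primal_obj T X G H x)"

definition solves_primal ::
    "nat \<Rightarrow> (nat \<Rightarrow> 'a topology) \<Rightarrow> (nat \<Rightarrow> 'a \<Rightarrow> real) \<Rightarrow>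
     (nat \<Rightarrow> ('a \<Rightarrow> real^'d) \<Rightarrow> ereal) \<Rightarrow> (((nat \<Rightarrow> 'a) \<Rightarrow> real^'d) \<Rightarrow> ereal) \<Rightarrow>
     (nat \<Rightarrow> 'a \<Rightarrow> real^'d) \<Rightarrow> bool" where
  "solves_primal T X \<psi> G H x \<longleftrightarrow>
     x \<in> prod_space T X \<psi> \<and> primal_obj T X G H x = primal_inf T X \<psi> G H"

definition value_fun ::
    "nat \<Rightarrow> (nat \<Rightarrow> 'a topology) \<Rightarrow> (nat \<Rightarrow> 'a \<Rightarrow> real) \<Rightarrow>
     (nat \<Rightarrow> ('a \<Rightarrow> real^'d) \<Rightarrow> ereal) \<Rightarrow> (((nat \<Rightarrow> 'a) \<Rightarrow> real^'d) \<Rightarrow> ereal) \<Rightarrow>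
     ((nat \<Rightarrow> 'a) \<Rightarrow> real^'d) \<Rightarrow> ereal" where
  "value_fun T X \<psi> G H u =
     (INF x\<in>prod_space T X \<psi>.
        (\<Sum>t\<le>T. G t (x t)) + H (\<lambda>s. u s - (\<Sum>t\<le>T. comp_proj T X t (x t) s)))"

definition dom_value_fun ::
    "nat \<Rightarrow> (nat \<Rightarrow> 'a topology) \<Rightarrow> (nat \<Rightarrow> 'a \<Rightarrow> real) \<Rightarrow>
     (nat \<Rightarrow> ('a \<Rightarrow> real^'d) \<Rightarrow> ereal) \<Rightarrow> (((nat \<Rightarrow> 'a) \<Rightarrow> real^'d) \<Rightarrow> ereal) \<Rightarrow>
     ((nat \<Rightarrow> 'a) \<Rightarrow> real^'d) set" where
  "dom_value_fun T X \<psi> G H =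
     {u \<in> weighted_space (path_top T X) (path_weight T \<psi>). value_fun T X \<psi> G H u < \<infinity>}"

definition dual_obj ::
    "nat \<Rightarrow> (nat \<Rightarrow> 'a topology) \<Rightarrow> (nat \<Rightarrow> 'a \<Rightarrow> real) \<Rightarrow>
     (nat \<Rightarrow> ('a \<Rightarrow> real^'d) \<Rightarrow> ereal) \<Rightarrow> (((nat \<Rightarrow> 'a) \<Rightarrow> real^'d) \<Rightarrow> ereal) \<Rightarrow>
     (((nat \<Rightarrow> 'a) \<Rightarrow> real^'d) \<Rightarrow> real) \<Rightarrow> ereal" where
  "dual_obj T X \<psi> G H l =
     (\<Sum>t\<le>T. conjugate (X t) (\<psi> t) (G t) (marginal T X t l)) +
     conjugate (path_top T X) (path_weight T \<psi>) H l"

definition dual_inf ::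
    "nat \<Rightarrow> (nat \<Rightarrow> 'a topology) \<Rightarrow> (nat \<Rightarrow> 'a \<Rightarrow> real) \<Rightarrow>
     (nat \<Rightarrow> ('a \<Rightarrow> real^'d) \<Rightarrow> ereal) \<Rightarrow> (((nat \<Rightarrow> 'a) \<Rightarrow> real^'d) \<Rightarrow> ereal) \<Rightarrow> ereal" where
  "dual_inf T X \<psi> G H =
     (INF l\<in>weighted_dual (path_top T X) (path_weight T \<psi>). dual_obj T X \<psi> G H l)"

text \<open>
  As attainment does not ask for a finite value, this also makes sense when the infimum is
  \<open>\<infinity>\<close>, that is, when the primal problem is unbounded below.
\<close>

definition solves_dual ::
    "nat \<Rightarrow> (nat \<Rightarrow> 'a topology) \<Rightarrow> (nat \<Rightarrow> 'a \<Rightarrow> real) \<Rightarrow>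
     (nat \<Rightarrow> ('a \<Rightarrow> real^'d) \<Rightarrow> ereal) \<Rightarrow> (((nat \<Rightarrow> 'a) \<Rightarrow> real^'d) \<Rightarrow> ereal) \<Rightarrow>
     (((nat \<Rightarrow> 'a) \<Rightarrow> real^'d) \<Rightarrow> real) \<Rightarrow> bool" where
  "solves_dual T X \<psi> G H l \<longleftrightarrow>
     l \<in> weighted_dual (path_top T X) (path_weight T \<psi>) \<and>
     dual_obj T X \<psi> G H l = dual_inf T X \<psi> G H"

definition optimality_conditions ::
    "nat \<Rightarrow> (nat \<Rightarrow> 'a topology) \<Rightarrow> (nat \<Rightarrow> 'a \<Rightarrow> real) \<Rightarrow>
     (nat \<Rightarrow> ('a \<Rightarrow> real^'d) \<Rightarrow> ereal) \<Rightarrow> (((nat \<Rightarrow> 'a) \<Rightarrow> real^'d) \<Rightarrow> ereal) \<Rightarrow>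
     (nat \<Rightarrow> 'a \<Rightarrow> real^'d) \<Rightarrow> (((nat \<Rightarrow> 'a) \<Rightarrow> real^'d) \<Rightarrow> real) \<Rightarrow> bool" where
  "optimality_conditions T X \<psi> G H x l \<longleftrightarrow>
     (\<forall>t\<le>T. marginal T X t l \<in> subdifferential (X t) (\<psi> t) (G t) (x t)) \<and>
     l \<in> subdifferential (path_top T X) (path_weight T \<psi>) H
           (\<lambda>s. - (\<Sum>t\<le>T. comp_proj T X t (x t) s))"

end

theory Submission
  imports Defs "HOL-Library.Function_Algebras"
begin

text \<open>
  The proof is by perturbation. Write \<open>A x = (\<Sum>t. x\<^sub>t \<circ> \<pi>\<^sub>t)\<close> and
  \<open>F x u = (\<Sum>t. G\<^sub>t x\<^sub>t) + H (u - A x)\<close>, and let \<open>\<phi> u\<close> be the infimum of \<open>F x u\<close> over \<open>x\<close>. The primal value is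
  \<open>\<phi> 0\<close>, and the dual objective at \<open>l\<close> is the conjugate of \<open>\<phi>\<close> at \<open>l\<close>. Hence the dual objective is always
  at least \<open>- \<phi> 0\<close> (\<open>weak_duality\<close>), and a functional \<open>l\<close> attains this value as soon as
  \<open>\<phi> 0 + l u \<le> \<phi> u\<close> for all \<open>u\<close>, that is, as soon as \<open>l\<close> is a subgradient of \<open>\<phi>\<close> at 0
  (\<open>dual_obj_le_of_subgradient\<close>). At a primal solution such a subgradient satisfies the optimality
  conditions (\<open>subgradient_imp_optimality_conditions\<close>); conversely, the optimality conditions close the
  gap between the objectives, so that both sides are optimal
  (\<open>optimality_conditions_imp_optimal\<close>).

  Everything therefore rests on a subgradient of \<open>\<phi>\<close> at 0 when \<open>\<phi> 0\<close> is finite, and this is where the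
  constraint qualification enters. The cone \<open>K\<close> generated by the domain of \<open>\<phi>\<close> is a closed subspace,
  hence complete. It is exhausted by multiples of the projections to \<open>u\<close> of the sets of all \<open>(x, u)\<close>
  for which the norm of \<open>x\<close> and the values \<open>G\<^sub>t x\<^sub>t\<close> and \<open>H (u - A x)\<close> are at most \<open>k\<close>. These sets are closed
  and convex, so by an open mapping argument (\<open>robinson_ursescu\<close>: Baire's theorem followed by a
  convex series) one of the projections contains a ball of \<open>K\<close> around 0. Consequently \<open>\<phi>\<close> is bounded above
  near 0 in \<open>K\<close>. A convex function with this property that is infinite outside \<open>K\<close> has a continuous
  subgradient on the whole space, by the Hahn--Banach theorem applied to the infimal convolution of its
  directional derivative with a multiple of the norm (\<open>subgradient_at_zero\<close>).

  The vector spaces are subspaces of function types with a seminorm on them. The completeness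
  of the weighted spaces is \<open>complete_weighted_space\<close>.
\<close>

section \<open>Dominated linear functionals\<close>

text \<open>Subadditivity and positive homogeneity on a subspace.\<close>

definition sublinear_on :: "'v::real_vector set \<Rightarrow> ('v \<Rightarrow> real) \<Rightarrow> bool" where
  "sublinear_on V p \<longleftrightarrow>
     (\<forall>x\<in>V. \<forall>y\<in>V. p (x + y) \<le> p x + p y) \<and> (\<forall>x\<in>V. \<forall>a\<ge>0. p (a *\<^sub>R x) = a * p x)"

lemma sublinear_on_add: "sublinear_on V p \<Longrightarrow> x \<in> V \<Longrightarrow> y \<in> V \<Longrightarrow> p (x + y) \<le> p x + p y"
  by (simp add: sublinear_on_def)

lemma sublinear_on_scale: "sublinear_on V p \<Longrightarrow> x \<in> V \<Longrightarrow> 0 \<le> a \<Longrightarrow> p (a *\<^sub>R x) = a * p x"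
  by (simp add: sublinear_on_def)

lemma sublinear_on_zero: "subspace V \<Longrightarrow> sublinear_on V p \<Longrightarrow> p 0 = 0"
  using sublinear_on_scale[of V p 0 0] subspace_0[of V] by simp

lemma sublinear_on_lower:
  assumes "subspace V" "sublinear_on V p" "x \<in> V"
  shows "- p (- x) \<le> p x"
  using sublinear_on_add[of V p x "-x"] sublinear_on_zero[of V p] subspace_neg[of V x] assms by simp

text \<open>
  Linearity on a subspace \<open>V\<close> only; the values of \<open>l\<close> outside \<open>V\<close> are irrelevant.
\<close>

definition linear_on :: "'v::real_vector set \<Rightarrow> ('v \<Rightarrow> real) \<Rightarrow> bool" where
  "linear_on V l \<longleftrightarrow>
     (\<forall>x\<in>V. \<forall>y\<in>V. l (x + y) = l x + l y) \<and> (\<forall>x\<in>V. \<forall>a. l (a *\<^sub>R x) = a * l x)"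

lemma linear_on_add: "linear_on V l \<Longrightarrow> x \<in> V \<Longrightarrow> y \<in> V \<Longrightarrow> l (x + y) = l x + l y"
  by (simp add: linear_on_def)

lemma linear_on_scale: "linear_on V l \<Longrightarrow> x \<in> V \<Longrightarrow> l (a *\<^sub>R x) = a * l x"
  by (simp add: linear_on_def)

lemma linear_on_neg: "linear_on V l \<Longrightarrow> x \<in> V \<Longrightarrow> l (- x) = - l x"
  using linear_on_scale[of V l x "-1"] by simp

lemma linear_on_diff: "subspace V \<Longrightarrow> linear_on V l \<Longrightarrow> x \<in> V \<Longrightarrow> y \<in> V \<Longrightarrow> l (x - y) = l x - l y"
  using linear_on_add[of V l x "-y"] linear_on_neg[of V l y] subspace_neg[of V y] by simp

lemma linear_on_sum:
  assumes "subspace V" "linear_on V l" "finite I" "\<And>i. i \<in> I \<Longrightarrow> f i \<in> V"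
  shows "l (\<Sum>i\<in>I. f i) = (\<Sum>i\<in>I. l (f i))"
  using assms(3,4)
proof (induction I rule: finite_induct)
  case empty
  show ?case using linear_on_scale[OF assms(2) subspace_0[OF assms(1)], of 0] by simp
next
  case (insert j I)
  then show ?case
    using linear_on_add[OF assms(2), of "f j" "\<Sum>i\<in>I. f i"] subspace_sum[OF assms(1), of I f] by simp
qed

text \<open>
  A chain of sublinear functionals has a sublinear pointwise infimum: the bound
  \<open>p x \<ge> - p (- x) \<ge> - q (- x)\<close> keeps the infimum finite, and for two members of the chain the
  smaller one witnesses subadditivity.
\<close>

lemma sublinear_on_INF_chain:
  assumes V: "subspace V" and ne: "C \<noteq> {}" and subl: "\<forall>p\<in>C. sublinear_on V p"
    and q: "\<forall>p\<in>C. \<forall>x\<in>V. p x \<le> q x"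
    and chain: "\<forall>p\<in>C. \<forall>p'\<in>C. (\<forall>x\<in>V. p x \<le> p' x) \<or> (\<forall>x\<in>V. p' x \<le> p x)"
  shows "sublinear_on V (\<lambda>x. INF p\<in>C. p x)"
    and "\<And>x p. x \<in> V \<Longrightarrow> p \<in> C \<Longrightarrow> (INF p\<in>C. p x) \<le> p x"
proof -
  note C = ne subl[rule_format]
  have bdd: "bdd_below ((\<lambda>p. p x) ` C)" if "x \<in> V" for x
  proof (rule bdd_belowI2)
    fix p assume "p \<in> C"
    then show "- q (- x) \<le> p x"
      using sublinear_on_lower[OF V C(2) that, of p] q[rule_format, of p "-x"] subspace_neg[OF V that] by force
  qed
  show low: "(INF p\<in>C. p x) \<le> p x" if "x \<in> V" "p \<in> C" for x p
    by (rule cINF_lower[OF bdd[OF that(1)] that(2)])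
  let ?u = "\<lambda>x. INF p\<in>C. p x"
  have sub: "?u (x + y) \<le> ?u x + ?u y" if x: "x \<in> V" and y: "y \<in> V" for x y
  proof -
    have xy: "x + y \<in> V" by (rule subspace_add[OF V x y])
    have le2: "?u (x + y) \<le> p x + p' y" if p: "p \<in> C" "p' \<in> C" for p p'
      using chain[rule_format, OF p]
    proof
      assume le: "\<forall>x\<in>V. p x \<le> p' x"
      have "?u (x + y) \<le> p x + p y"
        using low[OF xy p(1)] sublinear_on_add[OF C(2)[OF p(1)] x y] by linarith
      then show ?thesis using le y by force
    next
      assume le: "\<forall>x\<in>V. p' x \<le> p x"
      have "?u (x + y) \<le> p' x + p' y"
        using low[OF xy p(2)] sublinear_on_add[OF C(2)[OF p(2)] x y] by linarith
      then show ?thesis using le x by force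
    qed
    have "?u (x + y) - p x \<le> ?u y" if "p \<in> C" for p
      using le2[OF that] by (intro cINF_greatest[OF C(1)]) (simp add: algebra_simps)
    then have "?u (x + y) - ?u y \<le> ?u x"
      by (intro cINF_greatest[OF C(1)]) (simp add: algebra_simps)
    then show ?thesis by simp
  qed
  have scale1: "a * ?u x \<le> ?u (a *\<^sub>R x)" if x: "x \<in> V" and a: "0 < a" for x a
  proof (rule cINF_greatest[OF C(1)])
    fix p assume "p \<in> C"
    then show "a * ?u x \<le> p (a *\<^sub>R x)"
      using low[OF x] sublinear_on_scale[OF C(2) x, of p a] a by simp
  qed
  have "?u (a *\<^sub>R x) = a * ?u x" if x: "x \<in> V" and a: "0 \<le> a" for x a
  proof (cases "a = 0")
    case True
    have "?u 0 = (INF p\<in>C. 0)"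
      by (intro INF_cong refl) (simp add: sublinear_on_zero[OF V C(2)])
    then show ?thesis using True C(1) by simp
  next
    case False
    then have a: "0 < a" using a by simp
    have "inverse a * ?u (a *\<^sub>R x) \<le> ?u (inverse a *\<^sub>R (a *\<^sub>R x))"
      using a by (intro scale1 subspace_scale[OF V x]) simp
    then have "?u (a *\<^sub>R x) \<le> a * ?u x"
      using a by (simp add: field_simps)
    with scale1[OF x a] show ?thesis by simp
  qed
  with sub show "sublinear_on V ?u" unfolding sublinear_on_def by blast
qed

text \<open>
  If \<open>p\<close> is minimal, then for each \<open>y\<close> the sublinear functional
  \<open>x \<mapsto> inf {p (x + t y) - t p y | t \<ge> 0}\<close>, which lies below \<open>p\<close>, equals \<open>p\<close>; the value \<open>t = 1\<close> then
  gives superadditivity of \<open>p\<close>.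
\<close>

lemma minimal_sublinear_imp_linear:
  assumes V: "subspace V" and p: "sublinear_on V p"
    and min: "\<And>p'. sublinear_on V p' \<Longrightarrow> (\<And>x. x \<in> V \<Longrightarrow> p' x \<le> p x) \<Longrightarrow> (\<And>x. x \<in> V \<Longrightarrow> p' x = p x)"
  shows "linear_on V p"
proof -
  have add_ge: "p x + p y \<le> p (x + y)" if x: "x \<in> V" and y: "y \<in> V" for x y
  proof -
    let ?S = "\<lambda>x. (\<lambda>t. p (x + t *\<^sub>R y) - t * p y) ` {0..}"
    define p' where "p' x = Inf (?S x)" for x
    have bdd: "bdd_below (?S x)" if x: "x \<in> V" for x
    proof (rule bdd_belowI2)
      fix t :: real assume "t \<in> {0..}"
      then have "t * p y = p (t *\<^sub>R y)" using sublinear_on_scale[OF p y] by simp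
      also have "\<dots> = p ((x + t *\<^sub>R y) + - x)" by simp
      also have "\<dots> \<le> p (x + t *\<^sub>R y) + p (- x)"
        by (intro sublinear_on_add[OF p] subspace_add[OF V] subspace_scale[OF V] subspace_neg[OF V] x y)
      finally show "- p (- x) \<le> p (x + t *\<^sub>R y) - t * p y" by simp
    qed
    have le: "p' x \<le> p (x + t *\<^sub>R y) - t * p y" if "x \<in> V" "0 \<le> t" for x t
      unfolding p'_def using that by (intro cInf_lower bdd) auto
    have ge: "c \<le> p' x" if "\<And>t. 0 \<le> t \<Longrightarrow> c \<le> p (x + t *\<^sub>R y) - t * p y" for x c
      unfolding p'_def using that by (intro cInf_greatest) auto
    have sub: "p' (x + z) \<le> p' x + p' z" if x: "x \<in> V" and z: "z \<in> V" for x z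
    proof -
      have "p' (x + z) - (p (x + t *\<^sub>R y) - t * p y) \<le> p (z + s *\<^sub>R y) - s * p y" if "0 \<le> t" "0 \<le> s" for s t
      proof -
        have "p' (x + z) \<le> p ((x + z) + (t + s) *\<^sub>R y) - (t + s) * p y"
          using that by (intro le subspace_add[OF V] x z) auto
        also have "(x + z) + (t + s) *\<^sub>R y = (x + t *\<^sub>R y) + (z + s *\<^sub>R y)" by (simp add: algebra_simps)
        also have "p \<dots> \<le> p (x + t *\<^sub>R y) + p (z + s *\<^sub>R y)"
          by (intro sublinear_on_add[OF p] subspace_add[OF V] subspace_scale[OF V] x y z)
        finally show ?thesis by (simp add: algebra_simps)
      qed
      then have "p' (x + z) - (p (x + t *\<^sub>R y) - t * p y) \<le> p' z" if "0 \<le> t" for t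
        using that by (intro ge) auto
      then have "p' (x + z) - p' z \<le> p' x"
        by (intro ge) (simp add: algebra_simps)
      then show ?thesis by simp
    qed
    have scale_ge: "a * p' x \<le> p' (a *\<^sub>R x)" if x: "x \<in> V" and a: "0 < a" for x a
    proof (rule ge)
      fix t :: real assume t: "0 \<le> t"
      have "a * p' x \<le> a * (p (x + (t / a) *\<^sub>R y) - (t / a) * p y)"
        using a t by (intro mult_left_mono le x) auto
      also have "\<dots> = p (a *\<^sub>R (x + (t / a) *\<^sub>R y)) - t * p y"
        using a by (subst sublinear_on_scale[OF p]) (auto simp: algebra_simps intro!: subspace_add[OF V] subspace_scale[OF V] x y)
      also have "a *\<^sub>R (x + (t / a) *\<^sub>R y) = a *\<^sub>R x + t *\<^sub>R y"
        using a by (simp add: algebra_simps)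
      finally show "a * p' x \<le> p (a *\<^sub>R x + t *\<^sub>R y) - t * p y" .
    qed
    have p'p: "p' x \<le> p x" if "x \<in> V" for x using le[OF that, of 0] by simp
    have scale: "p' (a *\<^sub>R x) = a * p' x" if x: "x \<in> V" and a: "0 \<le> a" for x a
    proof (cases "a = 0")
      case True
      have "0 \<le> p' 0"
        by (rule ge) (simp add: sublinear_on_scale[OF p y])
      moreover have "p' 0 \<le> 0"
        using p'p[of 0] sublinear_on_zero[OF V p] subspace_0[OF V] by simp
      ultimately show ?thesis using True by simp
    next
      case False
      then have a: "0 < a" using a by simp
      have "inverse a * p' (a *\<^sub>R x) \<le> p' (inverse a *\<^sub>R (a *\<^sub>R x))"
        using a by (intro scale_ge subspace_scale[OF V x]) simp
      then have "p' (a *\<^sub>R x) \<le> a * p' x"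
        using a by (simp add: field_simps)
      with scale_ge[OF x a] show ?thesis by simp
    qed
    have "sublinear_on V p'" unfolding sublinear_on_def using sub scale by blast
    then have "p' x = p x" using min p'p x by blast
    with le[OF x, of 1] show ?thesis by simp
  qed
  have add: "p (x + y) = p x + p y" if "x \<in> V" "y \<in> V" for x y
    using add_ge[OF that] sublinear_on_add[OF p that] by simp
  have neg: "p (- x) = - p x" if "x \<in> V" for x
    using add[OF that subspace_neg[OF V that]] sublinear_on_zero[OF V p] by simp
  have "p (a *\<^sub>R x) = a * p x" if x: "x \<in> V" for a x
  proof (cases "0 \<le> a")
    case False
    then show ?thesis
      using sublinear_on_scale[OF p x, of "-a"] neg[OF subspace_scale[OF V x, of a]] by simp
  qed (rule sublinear_on_scale[OF p x])
  with add show ?thesis unfolding linear_on_def by blast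
qed

text \<open>
  The Hahn--Banach theorem in the form used below. By Zorn's lemma there is a minimal sublinear
  functional below \<open>q\<close>, and a minimal one is linear.
\<close>

lemma hahn_banach_dominated:
  fixes V :: "'v::real_vector set"
  assumes V: "subspace V" and q: "sublinear_on V q"
  obtains l where "linear_on V l" "\<And>x. x \<in> V \<Longrightarrow> l x \<le> q x"
proof -
  \<comment> \<open>Fixing the values outside \<open>V\<close> makes the pointwise order on \<open>V\<close> antisymmetric.\<close>
  define A where "A = {p. sublinear_on V p \<and> (\<forall>x\<in>V. p x \<le> q x) \<and> (\<forall>x. x \<notin> V \<longrightarrow> p x = 0)}"
  let ?P = "\<lambda>p p'. \<forall>x\<in>V. p' x \<le> (p x :: real)"
  have "partial_order_on A (relation_of ?P A)"
  proof (rule partial_order_on_relation_ofI)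
    fix a b assume ab: "a \<in> A" "b \<in> A" "?P a b" "?P b a"
    show "a = b"
    proof
      fix x show "a x = b x"
        using ab by (cases "x \<in> V") (auto simp: A_def intro: antisym)
    qed
  qed (auto intro: order_trans)
  moreover have "\<exists>u\<in>A. \<forall>p\<in>C. ?P p u" if C: "C \<in> Chains (relation_of ?P A)" for C
  proof (cases "C = {}")
    case True
    have "(\<lambda>x. if x \<in> V then q x else 0) \<in> A"
      using q V unfolding A_def sublinear_on_def by (auto simp: subspace_add subspace_scale)
    then show ?thesis using True by blast
  next
    case False
    have CA: "C \<subseteq> A" and ch: "\<forall>p\<in>C. \<forall>p'\<in>C. ?P p' p \<or> ?P p p'"
      using C unfolding Chains_def relation_of_def by blast+
    have C2: "\<forall>p\<in>C. sublinear_on V p" and q': "\<forall>p\<in>C. \<forall>x\<in>V. p x \<le> q x"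
      using CA unfolding A_def by auto
    have inf2: "(INF p\<in>C. p x) \<le> p x" if "x \<in> V" "p \<in> C" for x p
      by (rule sublinear_on_INF_chain(2)[OF V False C2 q' ch that])
    let ?u = "\<lambda>x. if x \<in> V then INF p\<in>C. p x else 0"
    have "sublinear_on V (\<lambda>x. INF p\<in>C. p x)"
      by (rule sublinear_on_INF_chain(1)[OF V False C2 q' ch])
    then have 1: "sublinear_on V ?u"
      using V unfolding sublinear_on_def by (auto simp: subspace_add subspace_scale)
    have 2: "?u x \<le> p x" if "x \<in> V" "p \<in> C" for x p using inf2[OF that] that by simp
    have "?u x \<le> q x" if "x \<in> V" for x
      using False 2[OF that] q'[rule_format, OF _ that] by (meson all_not_in_conv order_trans)
    with 1 have "?u \<in> A" unfolding A_def by auto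
    then show ?thesis by (rule bexI[rotated]) (intro ballI 2)
  qed
  ultimately have "\<exists>m\<in>A. \<forall>a\<in>A. ?P m a \<longrightarrow> a = m"
    by (rule predicate_Zorn)
  then obtain m where m: "m \<in> A" and min: "\<And>a. a \<in> A \<Longrightarrow> ?P m a \<Longrightarrow> a = m" by blast
  have "linear_on V m"
  proof (rule minimal_sublinear_imp_linear[OF V])
    show "sublinear_on V m" using m by (simp add: A_def)
    fix p' x assume p': "sublinear_on V p'" "\<And>x. x \<in> V \<Longrightarrow> p' x \<le> m x" and x: "x \<in> V"
    let ?a = "\<lambda>x. if x \<in> V then p' x else 0"
    have "sublinear_on V ?a"
      using p'(1) V unfolding sublinear_on_def by (auto simp: subspace_add subspace_scale)
    moreover have "\<forall>x\<in>V. ?a x \<le> q x" using p'(2) m by (fastforce simp: A_def)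
    ultimately have "?a \<in> A" unfolding A_def by auto
    then have "?a = m" using p'(2) by (intro min) auto
    then have "?a x = m x" by (rule fun_cong)
    with x show "p' x = m x" by simp
  qed
  moreover have "m x \<le> q x" if "x \<in> V" for x using m that by (auto simp: A_def)
  ultimately show thesis using that by blast
qed

section \<open>Subgradients of convex functions that are bounded above near zero\<close>

text \<open>
  A subspace of a real vector space with a seminorm that is meaningful on that subspace only.
\<close>

locale seminormed_subspace =
  fixes V :: "'v::real_vector set" and N :: "'v \<Rightarrow> real"
  assumes subspace: "subspace V"
    and N_add: "x \<in> V \<Longrightarrow> y \<in> V \<Longrightarrow> N (x + y) \<le> N x + N y"
    and N_scale: "x \<in> V \<Longrightarrow> N (a *\<^sub>R x) = \<bar>a\<bar> * N x"
begin

lemmas zero_mem = subspace_0[OF subspace]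
lemmas add_mem = subspace_add[OF subspace]
lemmas diff_mem = subspace_diff[OF subspace]
lemmas neg_mem = subspace_neg[OF subspace]
lemmas scale_mem = subspace_scale[OF subspace]

lemma N_zero: "N 0 = 0"
  using N_scale[OF zero_mem, of 0] by simp

lemma N_neg: "x \<in> V \<Longrightarrow> N (- x) = N x"
  using N_scale[of x "-1"] by simp

lemma N_nonneg: "x \<in> V \<Longrightarrow> 0 \<le> N x"
  using N_add[of x "-x"] N_neg[of x] N_zero neg_mem[of x] by simp

lemma N_diff_le: "x \<in> V \<Longrightarrow> y \<in> V \<Longrightarrow> N (x - y) \<le> N x + N y"
  using N_add[of x "-y"] N_neg[of y] neg_mem[of y] by simp

lemma N_minus_commute: "x \<in> V \<Longrightarrow> y \<in> V \<Longrightarrow> N (x - y) = N (y - x)"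
  using N_neg[of "x - y"] diff_mem[of x y] by simp

lemma N_diff_triangle: "x \<in> V \<Longrightarrow> y \<in> V \<Longrightarrow> z \<in> V \<Longrightarrow> N (x - z) \<le> N (x - y) + N (y - z)"
  using N_add[of "x - y" "y - z"] diff_mem by simp

end

lemma (in seminormed_subspace) N_sum_le:
  "finite I \<Longrightarrow> (\<And>i. i \<in> I \<Longrightarrow> f i \<in> V) \<Longrightarrow> N (\<Sum>i\<in>I. f i) \<le> (\<Sum>i\<in>I. N (f i))"
proof (induction I rule: finite_induct)
  case (insert j I)
  have "N (f j + (\<Sum>i\<in>I. f i)) \<le> N (f j) + N (\<Sum>i\<in>I. f i)"
    using insert by (intro N_add subspace_sum[OF subspace]) auto
  with insert show ?case by simp
qed (simp add: N_zero)

text \<open>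
  Convexity through the strict epigraph, which makes sense for functions that may take both
  values \<open>\<infinity>\<close> and \<open>-\<infinity>\<close>.
\<close>

definition convex_on_subspace :: "'v::real_vector set \<Rightarrow> ('v \<Rightarrow> ereal) \<Rightarrow> bool" where
  "convex_on_subspace V \<phi> \<longleftrightarrow>
     (\<forall>u\<in>V. \<forall>v\<in>V. \<forall>a b s. \<phi> u < ereal a \<longrightarrow> \<phi> v < ereal b \<longrightarrow> 0 < s \<longrightarrow> s < 1 \<longrightarrow>
        \<phi> (s *\<^sub>R u + (1 - s) *\<^sub>R v) < ereal (s * a + (1 - s) * b))"

text \<open>
  Assume that \<open>\<phi>\<close> is finite at 0 and that every sufficiently small negative multiple of a point of
  its domain has a value below \<open>B\<close>. Convexity on the segment from \<open>w\<close> to \<open>- t w\<close> gives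
  \<open>\<phi> w - \<phi> 0 \<ge> - M N w\<close> with \<open>M = (B - \<phi> 0) / r\<close>, so that
  \<open>q u = inf {\<tau> (a - \<phi> 0) + M N (u - \<tau> w) | \<tau> > 0, \<phi> w < a}\<close> is a finite sublinear functional
  with \<open>q \<le> M N\<close> and \<open>q u \<le> \<phi> u - \<phi> 0\<close>. A linear functional below \<open>q\<close> is a bounded subgradient on all
  of \<open>V\<close>, although \<open>\<phi>\<close> may be infinite outside a proper subspace.
\<close>

lemma (in seminormed_subspace) subgradient_at_zero:
  fixes \<phi> :: "'v \<Rightarrow> ereal"
  assumes conv: "convex_on_subspace V \<phi>" and c: "\<phi> 0 = ereal c" and r: "0 < r"
    and bound: "\<And>w t. w \<in> V \<Longrightarrow> \<phi> w < \<infinity> \<Longrightarrow> 0 < t \<Longrightarrow> N (t *\<^sub>R w) < r \<Longrightarrow> \<phi> (- (t *\<^sub>R w)) < ereal B"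
  obtains l M where "linear_on V l" "\<And>u. u \<in> V \<Longrightarrow> l u \<le> M * N u"
    "\<And>u. u \<in> V \<Longrightarrow> ereal (c + l u) \<le> \<phi> u"
proof -
  define M where "M = (B - c) / r"
  have "\<phi> (- (1 *\<^sub>R 0)) < ereal B"
    by (rule bound) (simp_all add: zero_mem c N_zero r)
  then have "c < B" using c by simp
  then have M: "0 < M" using r by (simp add: M_def)
  have lower: "- (M * N w) \<le> a - c" if w: "w \<in> V" and a: "\<phi> w < ereal a" for w a
  proof (rule field_le_epsilon)
    fix e :: real assume e: "0 < e"
    \<comment> \<open>The summand \<open>e / M\<close> covers the points of seminorm zero.\<close>
    define t where "t = r / (N w + e / M)"
    have pos: "0 < N w + e / M" using N_nonneg[OF w] e M by (simp add: add_nonneg_pos)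
    have t: "0 < t" using pos r by (simp add: t_def)
    have "t * N w < t * (N w + e / M)" using t e M by simp
    also have "\<dots> = r" using pos by (simp add: t_def)
    finally have "N (t *\<^sub>R w) < r" using N_scale[OF w, of t] t by simp
    then have neg: "\<phi> (- (t *\<^sub>R w)) < ereal B"
      using a t w by (intro bound) auto
    have s: "1 - t / (1 + t) = 1 / (1 + t)" using t by (simp add: field_simps)
    have comb: "(t / (1 + t)) *\<^sub>R w + (1 - t / (1 + t)) *\<^sub>R (- (t *\<^sub>R w)) = 0"
      unfolding s by simp
    have "\<phi> ((t / (1 + t)) *\<^sub>R w + (1 - t / (1 + t)) *\<^sub>R (- (t *\<^sub>R w)))
        < ereal (t / (1 + t) * a + (1 - t / (1 + t)) * B)"
      using conv[unfolded convex_on_subspace_def, rule_format,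
          of w "- (t *\<^sub>R w)" a B "t / (1 + t)"] w a t neg
      by (simp add: neg_mem scale_mem)
    then have "ereal c < ereal (t / (1 + t) * a + (1 - t / (1 + t)) * B)"
      by (simp only: comb c)
    then have "c < (t * a + B) / (1 + t)" by (simp add: s add_divide_distrib)
    then have "c * (1 + t) < t * a + B" using t by (simp add: pos_less_divide_eq)
    then have "- (B - c) < t * (a - c)" by (simp add: algebra_simps)
    moreover have "B - c = t * (M * N w + e)"
    proof -
      have "M * N w + e = M * (N w + e / M)" using M by (simp add: distrib_left)
      then have "t * (M * N w + e) = r * M" using pos by (simp add: t_def)
      then show ?thesis using r by (simp add: M_def)
    qed
    ultimately have "t * - (M * N w + e) < t * (a - c)" by (simp only: mult_minus_right)
    then have "- (M * N w + e) < a - c" using t by (simp only: mult_less_cancel_left_pos)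
    then show "- (M * N w) \<le> a - c + e" by simp
  qed
  let ?S = "\<lambda>u. {\<tau> * (a - c) + M * N (u - \<tau> *\<^sub>R w) | \<tau> w a. 0 < \<tau> \<and> w \<in> V \<and> \<phi> w < ereal a}"
  define q where "q u = Inf (?S u)" for u
  have low: "- (M * N u) \<le> \<tau> * (a - c) + M * N (u - \<tau> *\<^sub>R w)"
    if u: "u \<in> V" and "0 < \<tau>" "w \<in> V" "\<phi> w < ereal a" for u \<tau> w a
  proof -
    have "N (\<tau> *\<^sub>R w) \<le> N (u - \<tau> *\<^sub>R w) + N u"
      using N_diff_le[of u "u - \<tau> *\<^sub>R w"] that by (simp add: diff_mem scale_mem)
    then have "M * (\<tau> * N w) \<le> M * (N (u - \<tau> *\<^sub>R w) + N u)"
      using M that by (intro mult_left_mono) (auto simp: N_scale)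
    moreover have "\<tau> * - (M * N w) \<le> \<tau> * (a - c)"
      using that by (intro mult_left_mono lower) auto
    ultimately show ?thesis by (simp add: algebra_simps)
  qed
  have bdd: "bdd_below (?S u)" if "u \<in> V" for u
    by (rule bdd_belowI[of _ "- (M * N u)"]) (use low[OF that] in auto)
  have q_le: "q u \<le> \<tau> * (a - c) + M * N (u - \<tau> *\<^sub>R w)"
    if "u \<in> V" "0 < \<tau>" "w \<in> V" "\<phi> w < ereal a" for u \<tau> w a
    unfolding q_def by (rule cInf_lower[OF _ bdd[OF that(1)]]) (use that in blast)
  have c1: "\<phi> 0 < ereal (c + 1)" using c by simp
  have q_ge: "b \<le> q u"
    if "\<And>\<tau> w a. 0 < \<tau> \<Longrightarrow> w \<in> V \<Longrightarrow> \<phi> w < ereal a \<Longrightarrow> b \<le> \<tau> * (a - c) + M * N (u - \<tau> *\<^sub>R w)" for u b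
    unfolding q_def
  proof (rule cInf_greatest)
    have "1 * ((c + 1) - c) + M * N (u - 1 *\<^sub>R 0) \<in> ?S u"
      using c1 zero_mem zero_less_one by blast
    then show "?S u \<noteq> {}" by blast
  qed (use that in blast)
  have q_N: "q u \<le> M * N u" if u: "u \<in> V" for u
  proof (rule field_le_epsilon)
    fix e :: real assume "0 < e"
    then show "q u \<le> M * N u + e"
      using q_le[OF u zero_less_one zero_mem, of "c + e"] c by simp
  qed
  have sub: "q (u + v) \<le> q u + q v" if u: "u \<in> V" and v: "v \<in> V" for u v
  proof -
    have two: "q (u + v) \<le> (\<tau> * (a - c) + M * N (u - \<tau> *\<^sub>R w)) + (\<sigma> * (b - c) + M * N (v - \<sigma> *\<^sub>R z))"
      if \<tau>: "0 < \<tau>" "w \<in> V" "\<phi> w < ereal a" and \<sigma>: "0 < \<sigma>" "z \<in> V" "\<phi> z < ereal b" for \<tau> w a \<sigma> z b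
    proof -
      \<comment> \<open>The two admissible triples are merged by convexity.\<close>
      let ?s = "\<tau> / (\<tau> + \<sigma>)"
      have s: "1 - ?s = \<sigma> / (\<tau> + \<sigma>)" "0 < ?s" "?s < 1" using \<tau> \<sigma> by (simp_all add: field_simps)
      let ?w = "?s *\<^sub>R w + (1 - ?s) *\<^sub>R z" and ?a = "?s * a + (1 - ?s) * b"
      have w: "?w \<in> V" by (intro add_mem scale_mem \<tau> \<sigma>)
      have "\<phi> ?w < ereal ?a"
        using conv[unfolded convex_on_subspace_def, rule_format, OF \<tau>(2) \<sigma>(2) \<tau>(3) \<sigma>(3) s(2,3)] .
      then have "q (u + v) \<le> (\<tau> + \<sigma>) * (?a - c) + M * N ((u + v) - (\<tau> + \<sigma>) *\<^sub>R ?w)"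
        using \<tau> \<sigma> by (intro q_le add_mem u v w) auto
      also have "(\<tau> + \<sigma>) *\<^sub>R ?w = \<tau> *\<^sub>R w + \<sigma> *\<^sub>R z"
        using \<tau> \<sigma> unfolding s(1) by (simp add: scaleR_add_right)
      also have "(\<tau> + \<sigma>) * (?a - c) = \<tau> * (a - c) + \<sigma> * (b - c)"
      proof -
        have "(\<tau> + \<sigma>) * ?s = \<tau>" "(\<tau> + \<sigma>) * (1 - ?s) = \<sigma>" using \<tau> \<sigma> unfolding s(1) by simp_all
        then have "(\<tau> + \<sigma>) * ?a = \<tau> * a + \<sigma> * b" by (simp only: distrib_left mult.assoc[symmetric])
        then show ?thesis by (simp only: right_diff_distrib distrib_right)
      qed
      also have "(u + v) - (\<tau> *\<^sub>R w + \<sigma> *\<^sub>R z) = (u - \<tau> *\<^sub>R w) + (v - \<sigma> *\<^sub>R z)" by simp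
      also have "M * N \<dots> \<le> M * (N (u - \<tau> *\<^sub>R w) + N (v - \<sigma> *\<^sub>R z))"
        using M by (intro mult_left_mono N_add diff_mem scale_mem u v \<tau> \<sigma>) simp
      finally show ?thesis by (simp add: algebra_simps)
    qed
    have one: "q (u + v) - (\<tau> * (a - c) + M * N (u - \<tau> *\<^sub>R w)) \<le> q v"
      if \<tau>: "0 < \<tau>" "w \<in> V" "\<phi> w < ereal a" for \<tau> w a
    proof (rule q_ge)
      fix \<sigma> b :: real and z assume "0 < \<sigma>" "z \<in> V" "\<phi> z < ereal b"
      from two[OF \<tau> this]
      show "q (u + v) - (\<tau> * (a - c) + M * N (u - \<tau> *\<^sub>R w)) \<le> \<sigma> * (b - c) + M * N (v - \<sigma> *\<^sub>R z)"
        by linarith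
    qed
    have "q (u + v) - q v \<le> q u"
    proof (rule q_ge)
      fix \<tau> a :: real and w assume "0 < \<tau>" "w \<in> V" "\<phi> w < ereal a"
      from one[OF this] show "q (u + v) - q v \<le> \<tau> * (a - c) + M * N (u - \<tau> *\<^sub>R w)"
        by linarith
    qed
    then show ?thesis by simp
  qed
  have scale_ge: "k * q u \<le> q (k *\<^sub>R u)" if u: "u \<in> V" and k: "0 < k" for u k
  proof (rule q_ge)
    fix \<tau> a :: real and w assume w: "0 < \<tau>" "w \<in> V" "\<phi> w < ereal a"
    have "k * q u \<le> k * ((\<tau> / k) * (a - c) + M * N (u - (\<tau> / k) *\<^sub>R w))"
      using k w by (intro mult_left_mono q_le u) auto
    also have "\<dots> = \<tau> * (a - c) + M * N (k *\<^sub>R (u - (\<tau> / k) *\<^sub>R w))"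
      using k N_scale[of "u - (\<tau> / k) *\<^sub>R w" k] u w
      by (simp add: diff_mem scale_mem distrib_left del: scaleR_diff_right)
    also have "k *\<^sub>R (u - (\<tau> / k) *\<^sub>R w) = k *\<^sub>R u - \<tau> *\<^sub>R w"
      using k by (simp add: scaleR_diff_right)
    finally show "k * q u \<le> \<tau> * (a - c) + M * N (k *\<^sub>R u - \<tau> *\<^sub>R w)" .
  qed
  have "q 0 = 0"
  proof (rule antisym)
    show "q 0 \<le> 0" using q_N[OF zero_mem] by (simp add: N_zero)
    show "0 \<le> q 0" by (rule q_ge) (use low[OF zero_mem] in \<open>simp add: N_zero\<close>)
  qed
  moreover have "q (k *\<^sub>R u) = k * q u" if u: "u \<in> V" and k: "0 < k" for u k
  proof -
    have "inverse k * q (k *\<^sub>R u) \<le> q (inverse k *\<^sub>R (k *\<^sub>R u))"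
      using k by (intro scale_ge scale_mem u) simp
    then have "q (k *\<^sub>R u) \<le> k * q u" using k by (simp add: field_simps)
    with scale_ge[OF u k] show ?thesis by simp
  qed
  ultimately have "q (k *\<^sub>R u) = k * q u" if "u \<in> V" "0 \<le> k" for u k
    using that by (cases "k = 0") auto
  with sub have "sublinear_on V q" unfolding sublinear_on_def by blast
  then obtain l where l: "linear_on V l" "\<And>u. u \<in> V \<Longrightarrow> l u \<le> q u"
    by (rule hahn_banach_dominated[OF subspace]) blast
  show thesis
  proof (rule that[OF l(1)])
    show "l u \<le> M * N u" if "u \<in> V" for u using l(2)[OF that] q_N[OF that] by linarith
    show "ereal (c + l u) \<le> \<phi> u" if u: "u \<in> V" for u
    proof (rule dense_ge)
      fix y assume y: "\<phi> u < y"
      show "ereal (c + l u) \<le> y"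
      proof (cases y)
        case (real a)
        then have "l u \<le> 1 * (a - c) + M * N (u - 1 *\<^sub>R u)"
          using l(2)[OF u] q_le[OF u zero_less_one u, of a] y by simp
        then show ?thesis using real by (simp add: N_zero)
      qed (use y in auto)
    qed
  qed
qed

section \<open>An open mapping theorem for convex sets\<close>

text \<open>Cauchy sequences converge; as \<open>N\<close> is only a seminorm, limits need not be unique.\<close>

locale complete_seminormed_subspace = seminormed_subspace V N
  for V :: "'v::real_vector set" and N +
  assumes complete: "\<lbrakk>\<And>n. x n \<in> V; \<And>e. 0 < e \<Longrightarrow> \<exists>k. \<forall>m\<ge>k. \<forall>n\<ge>k. N (x m - x n) < e\<rbrakk>
     \<Longrightarrow> \<exists>l\<in>V. (\<lambda>n. N (x n - l)) \<longlonglongrightarrow> 0"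
begin

lemma geometric_convergent:
  assumes x: "\<And>n. x n \<in> V" and step: "\<And>n. N (x (Suc n) - x n) \<le> C * (1/2)^n"
  shows "\<exists>l\<in>V. (\<lambda>n. N (x n - l)) \<longlonglongrightarrow> 0"
proof (rule complete[OF x])
  have tail: "N (x (k + j) - x k) \<le> C * (2 * (1/2)^k - 2 * (1/2)^(k + j))" for k j
  proof (induction j)
    case 0 then show ?case by (simp add: N_zero)
  next
    case (Suc j)
    have "N (x (k + Suc j) - x k) \<le> N (x (Suc (k + j)) - x (k + j)) + N (x (k + j) - x k)"
      using N_diff_triangle[OF x x x] by simp
    also have "\<dots> \<le> C * (1/2)^(k + j) + C * (2 * (1/2)^k - 2 * (1/2)^(k + j))"
      by (intro add_mono step Suc)
    finally show ?case by (simp add: algebra_simps)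
  qed
  have "0 \<le> C" using order_trans[OF N_nonneg[OF diff_mem[OF x x]] step[of 0]] by simp
  then have tail': "N (x (k + j) - x k) \<le> (2 * C) * (1/2)^k" for k j
  proof -
    have "C * (2 * (1/2)^k - 2 * (1/2)^(k + j)) \<le> C * (2 * (1/2)^k)"
      using \<open>0 \<le> C\<close> by (intro mult_left_mono) simp_all
    with tail[of k j] show ?thesis by simp
  qed
  fix e :: real assume e: "0 < e"
  have "(\<lambda>k. (2 * C) * (1/2)^k) \<longlonglongrightarrow> (2 * C) * 0"
    by (intro tendsto_mult tendsto_const LIMSEQ_power_zero) simp
  then have "eventually (\<lambda>k. (2 * C) * (1/2)^k < e / 2) sequentially"
    using e by (intro order_tendstoD(2)) auto
  then obtain k where k: "(2 * C) * (1/2)^k < e / 2"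
    by (meson eventually_sequentially order_refl)
  have "N (x m - x n) < e" if "k \<le> m" "k \<le> n" for m n
  proof -
    have "N (x m - x n) \<le> N (x m - x k) + N (x k - x n)"
      by (rule N_diff_triangle[OF x x x])
    also have "\<dots> \<le> (2 * C) * (1/2)^k + (2 * C) * (1/2)^k"
      using tail'[of k "m - k"] tail'[of k "n - k"] that N_minus_commute[OF x x, of k n] by simp
    finally show ?thesis using k by simp
  qed
  then show "\<exists>k. \<forall>m\<ge>k. \<forall>n\<ge>k. N (x m - x n) < e" by blast
qed

lemma metric_space_mcomplete:
  assumes "\<And>x. x \<in> V \<Longrightarrow> N x = 0 \<Longrightarrow> x = 0"
  defines "d \<equiv> \<lambda>x y. if x \<in> V \<and> y \<in> V then N (x - y) else 0"
  shows "Metric_space V d" and "Metric_space.mcomplete V d"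
proof -
  show ms: "Metric_space V d"
  proof
    show "0 \<le> d x y" for x y by (simp add: d_def N_nonneg diff_mem)
    show "d x y = d y x" for x y by (simp add: d_def N_minus_commute)
    show "d x y = 0 \<longleftrightarrow> x = y" if "x \<in> V" "y \<in> V" for x y
      using that assms(1)[of "x - y"] by (auto simp: d_def N_zero diff_mem)
    show "d x z \<le> d x y + d y z" if "x \<in> V" "y \<in> V" "z \<in> V" for x y z
      using that by (simp add: d_def N_diff_triangle)
  qed
  interpret Metric_space V d by (rule ms)
  show mcomplete
    unfolding mcomplete_def MCauchy_def
  proof (intro allI impI, elim conjE)
    fix x :: "nat \<Rightarrow> 'v"
    assume x: "range x \<subseteq> V" and cauchy: "\<forall>e>0. \<exists>k. \<forall>m n. k \<le> m \<longrightarrow> k \<le> n \<longrightarrow> d (x m) (x n) < e"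
    have xV: "x n \<in> V" for n using x by auto
    have "\<exists>l\<in>V. (\<lambda>n. N (x n - l)) \<longlonglongrightarrow> 0"
    proof (rule complete[OF xV])
      fix e :: real assume "0 < e"
      then show "\<exists>k. \<forall>m\<ge>k. \<forall>n\<ge>k. N (x m - x n) < e"
        using cauchy xV by (simp add: d_def)
    qed
    then obtain l where l: "l \<in> V" "(\<lambda>n. N (x n - l)) \<longlonglongrightarrow> 0" by blast
    have "limitin mtopology x l sequentially"
      unfolding limitin_metric
    proof (intro conjI allI impI)
      fix e :: real assume "0 < e"
      then have "eventually (\<lambda>n. N (x n - l) < e) sequentially"
        by (rule order_tendstoD(2)[OF l(2)])
      then show "\<forall>\<^sub>F n in sequentially. x n \<in> V \<and> d (x n) l < e"
        by (rule eventually_mono) (simp add: xV l(1) d_def)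
    qed (rule l(1))
    then show "\<exists>l. limitin mtopology x l sequentially" by blast
  qed
qed

end

text \<open>
  Baire's theorem for closures: some member of a countable cover of \<open>V\<close> is dense in a ball.
\<close>

lemma (in complete_seminormed_subspace) baire_ball:
  fixes S :: "nat \<Rightarrow> 'v set"
  assumes definite: "\<And>x. x \<in> V \<Longrightarrow> N x = 0 \<Longrightarrow> x = 0"
    and S: "V \<subseteq> (\<Union>n. S n)"
  obtains n u0 r where "u0 \<in> V" "0 < r"
    "\<And>u e. u \<in> V \<Longrightarrow> N (u - u0) < r \<Longrightarrow> 0 < e \<Longrightarrow> \<exists>s\<in>S n \<inter> V. N (u - s) < e"
proof -
  define d where "d \<equiv> \<lambda>x y. if x \<in> V \<and> y \<in> V then N (x - y) else 0"
  note ms = metric_space_mcomplete[OF definite, folded d_def]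
  interpret Metric_space V d by (rule ms(1))
  let ?C = "\<lambda>n. mtopology closure_of (S n)"
  have "\<exists>n. mtopology interior_of ?C n \<noteq> {}"
  proof (rule ccontr)
    assume "\<not> ?thesis"
    then have "mtopology interior_of \<Union>(range ?C) = {}"
      by (intro metric_Baire_category_alt ms(2)) auto
    moreover have "V \<subseteq> \<Union>(range ?C)"
    proof
      fix v assume v: "v \<in> V"
      then obtain n where "v \<in> S n" using S by blast
      then have "v \<in> ?C n" using v closure_of_subset_Int[of mtopology "S n"] by auto
      then show "v \<in> \<Union>(range ?C)" by blast
    qed
    then have "mtopology interior_of V \<subseteq> mtopology interior_of \<Union>(range ?C)"
      by (rule interior_of_mono)
    moreover have "mtopology interior_of V = V" by (simp add: interior_of_eq)
    ultimately show False using zero_mem by blast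
  qed
  then obtain n u0 where "u0 \<in> mtopology interior_of ?C n" by blast
  then obtain r where u0: "u0 \<in> V" and r: "0 < r" "mball u0 r \<subseteq> ?C n"
    unfolding metric_interior_of by blast
  have "\<exists>s\<in>S n \<inter> V. N (u - s) < e" if u: "u \<in> V" "N (u - u0) < r" and e: "0 < e" for u e
  proof -
    have "u \<in> mball u0 r" using u u0 N_minus_commute[OF u(1) u0] unfolding in_mball by (simp add: d_def)
    then have "u \<in> ?C n" using r by blast
    then obtain y where "y \<in> S n" "y \<in> mball u e" using e unfolding metric_closure_of by blast
    moreover from this have "y \<in> V" "d u y < e" unfolding in_mball by blast+
    ultimately show ?thesis using u(1) by (auto simp: d_def)
  qed
  with u0 r(1) show thesis using that by blast
qed

text \<open>
  An open mapping theorem in the manner of Robinson and Ursescu, for an increasing sequence of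
  closed convex sets \<open>D k\<close> with bounded first components. If the multiples of their second
  components exhaust the complete space \<open>K\<close>, then the second components of one \<open>D k\<close> contain a
  neighbourhood of 0. Baire's theorem yields only a dense subset of a ball, which the absorbing
  property moves to the origin. Density is removed by writing a small \<open>u\<close> as a convex series
  \<open>\<Sum>i. 2\<^bsup>-(i+1)\<^esup> a\<^sub>i\<close> of second components of points of \<open>D k\<close>: the first components of these points
  are bounded, so that their convex series converges too, and \<open>D k\<close> is closed.
\<close>

lemma robinson_ursescu:
  fixes D :: "nat \<Rightarrow> ('w::real_vector \<times> 'v::real_vector) set"
  assumes K: "complete_seminormed_subspace K N" and definite: "\<And>u. u \<in> K \<Longrightarrow> N u = 0 \<Longrightarrow> u = 0"
    and W: "complete_seminormed_subspace W R"
    and sub: "\<And>k. D k \<subseteq> W \<times> K"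
    and mono: "\<And>j k. j \<le> k \<Longrightarrow> D j \<subseteq> D k"
    and conv: "\<And>k. convex (D k)"
    and bounded: "\<And>k. \<exists>B. \<forall>(x, u)\<in>D k. R x \<le> B"
    and closed: "\<And>k x u x' u'. \<lbrakk>\<And>n. (x n, u n) \<in> D k; x' \<in> W; u' \<in> K;
        (\<lambda>n. R (x n - x')) \<longlonglongrightarrow> 0; (\<lambda>n. N (u n - u')) \<longlonglongrightarrow> 0\<rbrakk> \<Longrightarrow> (x', u') \<in> D k"
    and absorb: "\<And>u. u \<in> K \<Longrightarrow> \<exists>\<alpha>>0. \<exists>k x v. (x, v) \<in> D k \<and> u = \<alpha> *\<^sub>R v"
  obtains k r where "0 < r" "\<And>u. u \<in> K \<Longrightarrow> N u < r \<Longrightarrow> \<exists>x. (x, u) \<in> D k"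
proof -
  interpret K: complete_seminormed_subspace K N by (rule K)
  interpret W: complete_seminormed_subspace W R by (rule W)
  define A where "A k = snd ` D k" for k
  have AK: "A k \<subseteq> K" for k using sub[of k] by (auto simp: A_def)
  have Amono: "A j \<subseteq> A k" if "j \<le> k" for j k using mono[OF that] by (auto simp: A_def)
  have Aconv: "s *\<^sub>R a + (1 - s) *\<^sub>R b \<in> A k" if ab: "a \<in> A k" "b \<in> A k" and s: "0 \<le> s" "s \<le> 1" for s a b k
  proof -
    obtain x y where "(x, a) \<in> D k" "(y, b) \<in> D k" using ab by (auto simp: A_def)
    then have "s *\<^sub>R (x, a) + (1 - s) *\<^sub>R (y, b) \<in> D k"
      using s by (intro convexD conv) auto
    then show ?thesis by (force simp: A_def)
  qed
  have absorbA: "\<exists>\<alpha>>0. \<exists>k. \<exists>v\<in>A k. u = \<alpha> *\<^sub>R v" if "u \<in> K" for u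
    using absorb[OF that] unfolding A_def by force
  \<comment> \<open>As 0 is a positive multiple of a point of some \<open>A k0\<close>, that point is 0.\<close>
  obtain k0 where k0: "0 \<in> A k0"
    using absorbA[OF K.zero_mem] by auto
  have "K \<subseteq> (\<Union>n. (\<lambda>v. real (Suc n) *\<^sub>R v) ` A n)"
  proof
    fix u assume "u \<in> K"
    then obtain \<alpha> k v where \<alpha>: "0 < \<alpha>" and v: "v \<in> A k" and u: "u = \<alpha> *\<^sub>R v" using absorbA by blast
    define n where "n = max (max k k0) (nat \<lceil>\<alpha>\<rceil>)"
    have n: "\<alpha> \<le> real (Suc n)" unfolding n_def by linarith
    have "k \<le> n" "k0 \<le> n" by (simp_all add: n_def)
    then have "v \<in> A n" "0 \<in> A n" using v k0 Amono[of k n] Amono[of k0 n] by auto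
    then have "(\<alpha> / real (Suc n)) *\<^sub>R v + (1 - \<alpha> / real (Suc n)) *\<^sub>R 0 \<in> A n"
      using \<alpha> n by (intro Aconv) auto
    then have "(\<alpha> / real (Suc n)) *\<^sub>R v \<in> A n" by simp
    moreover have "u = real (Suc n) *\<^sub>R ((\<alpha> / real (Suc n)) *\<^sub>R v)" using u by simp
    ultimately have "u \<in> (\<lambda>v. real (Suc n) *\<^sub>R v) ` A n" by (rule image_eqI[rotated])
    then show "u \<in> (\<Union>n. (\<lambda>v. real (Suc n) *\<^sub>R v) ` A n)" by blast
  qed
  from K.baire_ball[OF definite this] obtain n u0 r0 where u0: "u0 \<in> K" and r0: "0 < r0"
    and ball: "\<And>u e. u \<in> K \<Longrightarrow> N (u - u0) < r0 \<Longrightarrow> 0 < e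
        \<Longrightarrow> \<exists>s\<in>(\<lambda>v. real (Suc n) *\<^sub>R v) ` A n \<inter> K. N (u - s) < e"
    by metis
  obtain \<alpha> j v where \<alpha>: "0 < \<alpha>" and v: "v \<in> A j" and u0v: "- u0 = \<alpha> *\<^sub>R v"
    using absorbA[OF K.neg_mem[OF u0]] by blast
  define m where "m = max n j"
  have mj: "n \<le> m" "j \<le> m" by (simp_all add: m_def)
  define c where "c = real (Suc n)"
  have c: "0 < c" by (simp add: c_def)
  define \<rho> where "\<rho> = r0 / (c + \<alpha>)"
  have \<rho>: "0 < \<rho>" using r0 c \<alpha> by (simp add: \<rho>_def)
  \<comment> \<open>A point of the ball around \<open>u0\<close>, scaled, is combined with a point \<open>v\<close> on the ray through \<open>- u0\<close>.\<close>
  have dense: "\<exists>a\<in>A m. N (u - a) < e" if u: "u \<in> K" "N u < \<rho>" and e: "0 < e" for u e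
  proof -
    let ?w = "(c + \<alpha>) *\<^sub>R u"
    have "N ?w < r0" using u c \<alpha> K.N_scale[OF u(1), of "c + \<alpha>"] by (simp add: \<rho>_def field_simps)
    then obtain a where a: "a \<in> A n" and Na: "N (u0 + ?w - c *\<^sub>R a) < (c + \<alpha>) * e"
      using ball[of "u0 + ?w" "(c + \<alpha>) * e"] u0 u e c \<alpha> unfolding c_def[symmetric]
      by (auto simp: K.add_mem K.scale_mem)
    let ?s = "c / (c + \<alpha>)" and ?i = "1 / (c + \<alpha>)"
    have s: "1 - ?s = \<alpha> / (c + \<alpha>)" using c \<alpha> by (simp add: field_simps)
    let ?a = "?s *\<^sub>R a + (1 - ?s) *\<^sub>R v"
    have "?a \<in> A m"
      using a v Amono[of n m] Amono[of j m] c \<alpha> mj by (intro Aconv) auto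
    moreover have "u - ?a = ?i *\<^sub>R (u0 + ?w - c *\<^sub>R a)"
    proof -
      have u0': "u0 = - (\<alpha> *\<^sub>R v)" using u0v by (metis minus_minus)
      have "?i *\<^sub>R (u0 + ?w - c *\<^sub>R a) = ?i *\<^sub>R u0 + ?i *\<^sub>R ?w - ?i *\<^sub>R c *\<^sub>R a"
        by (simp only: scaleR_add_right scaleR_diff_right)
      also have "?i *\<^sub>R u0 = - ((1 - ?s) *\<^sub>R v)" unfolding s u0' by simp
      also have "?i *\<^sub>R ?w = u" using c \<alpha> by simp
      also have "?i *\<^sub>R c *\<^sub>R a = ?s *\<^sub>R a" by simp
      finally show ?thesis by (simp only:) (simp add: algebra_simps)
    qed
    moreover have "N (?i *\<^sub>R (u0 + ?w - c *\<^sub>R a)) < e"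
    proof -
      have "N (?i *\<^sub>R (u0 + ?w - c *\<^sub>R a)) = ?i * N (u0 + ?w - c *\<^sub>R a)"
      proof -
        have "a \<in> K" using a AK by blast
        then have "u0 + ?w - c *\<^sub>R a \<in> K" by (intro K.add_mem K.diff_mem K.scale_mem u0 u(1))
        then show ?thesis using K.N_scale[of "u0 + ?w - c *\<^sub>R a" ?i] c \<alpha> by simp
      qed
      also have "\<dots> < ?i * ((c + \<alpha>) * e)" using Na c \<alpha> by (intro mult_strict_left_mono) auto
      also have "\<dots> = e" using c \<alpha> by simp
      finally show ?thesis .
    qed
    ultimately show ?thesis by (intro bexI[of _ ?a]) simp_all
  qed
  have half: "\<exists>x. (x, u) \<in> D m" if uK: "u \<in> K" and uN: "N u < \<rho> / 2" for u
  proof -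
    have ex: "\<exists>d\<in>D m. N (z - snd d) < \<rho> / 2" if "z \<in> K" "N z < \<rho>" for z
      using dense[OF that, of "\<rho> / 2"] \<rho> unfolding A_def by simp
    define pick where "pick z = (SOME d. d \<in> D m \<and> N (z - snd d) < \<rho> / 2)" for z
    have pick: "pick z \<in> D m" "N (z - snd (pick z)) < \<rho> / 2" if "z \<in> K" "N z < \<rho>" for z
      using someI_ex[OF ex[OF that, unfolded Bex_def]] unfolding pick_def by blast+
    \<comment> \<open>\<open>z i\<close> is the remainder of the expansion after \<open>i\<close> terms, rescaled by \<open>2\<^bsup>i+1\<^esup>\<close>.\<close>
    define z where "z = rec_nat (2 *\<^sub>R u) (\<lambda>_ z. 2 *\<^sub>R (z - snd (pick z)))"
    have z0: "z 0 = 2 *\<^sub>R u" and zS: "z (Suc i) = 2 *\<^sub>R (z i - snd (pick (z i)))" for i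
      by (simp_all add: z_def)
    have DK: "snd d \<in> K" "fst d \<in> W" if "d \<in> D m" for d using sub[of m] that by auto
    have zK: "z i \<in> K \<and> N (z i) < \<rho>" for i
    proof (induction i)
      case 0 then show ?case using uK uN K.N_scale[OF uK, of 2] by (simp add: z0 K.scale_mem)
    next
      case (Suc i)
      have "z i - snd (pick (z i)) \<in> K" using Suc pick DK by (simp add: K.diff_mem)
      then show ?case using pick(2)[of "z i"] Suc K.N_scale[of "z i - snd (pick (z i))" 2]
        by (simp add: zS K.scale_mem)
    qed
    define d where "d i = pick (z i)" for i
    have dD: "d i \<in> D m" for i using pick zK by (simp add: d_def)
    \<comment> \<open>The partial sums of the series, with the missing weight \<open>2\<^bsup>-i\<^esup>\<close> put on \<open>d 0\<close>, stay in \<open>D m\<close>.\<close>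
    define s where "s = rec_nat (d 0) (\<lambda>i s. s + (1/2)^Suc i *\<^sub>R (d i - d 0))"
    have s0: "s 0 = d 0" and sS: "s (Suc i) = s i + (1/2)^Suc i *\<^sub>R (d i - d 0)" for i
      by (simp_all add: s_def)
    have shift: "s i + (1/2)^i *\<^sub>R (e - d 0) \<in> D m" if "e \<in> D m" for i e
      using that
    proof (induction i arbitrary: e)
      case 0 then show ?case by (simp add: s0)
    next
      case (Suc i)
      have "(1/2) *\<^sub>R d i + (1/2) *\<^sub>R e \<in> D m"
        using conv[of m] dD Suc.prems unfolding convex_def by simp
      from Suc.IH[OF this]
      have "s i + (1/2)^i *\<^sub>R ((1/2) *\<^sub>R d i + (1/2) *\<^sub>R e - d 0) \<in> D m" .
      moreover have "s (Suc i) + (1/2)^Suc i *\<^sub>R (e - d 0) =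
          s i + (1/2)^i *\<^sub>R ((1/2) *\<^sub>R d i + (1/2) *\<^sub>R e - d 0)"
      proof -
        have "(1/2) *\<^sub>R (d i - d 0) + (1/2) *\<^sub>R (e - d 0)
            = (1/2) *\<^sub>R d i + (1/2) *\<^sub>R e - ((1/2) *\<^sub>R d 0 + (1/2) *\<^sub>R d 0)"
          by (simp add: scaleR_diff_right)
        also have "(1/2) *\<^sub>R d 0 + (1/2) *\<^sub>R d 0 = d 0"
          by (simp only: scaleR_add_left[symmetric]) simp
        finally have "(1/2) *\<^sub>R d i + (1/2) *\<^sub>R e - d 0 = (1/2) *\<^sub>R (d i - d 0) + (1/2) *\<^sub>R (e - d 0)" ..
        then show ?thesis by (simp add: sS scaleR_add_right mult.commute)
      qed
      ultimately show ?case by simp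
    qed
    have sD: "s i \<in> D m" for i using shift[OF dD[of 0], of i] by simp
    have resid: "snd (s i) - u = (1/2)^i *\<^sub>R snd (d 0) - (1/2)^Suc i *\<^sub>R z i" for i
    proof (induction i)
      case 0 then show ?case by (simp add: s0 z0)
    next
      case (Suc i)
      have "snd (s (Suc i)) - u = (snd (s i) - u) + (1/2)^Suc i *\<^sub>R (snd (d i) - snd (d 0))"
        by (simp add: sS)
      also have "\<dots> = ((1/2)^i *\<^sub>R snd (d 0) - (1/2)^Suc i *\<^sub>R snd (d 0)) - (1/2)^Suc i *\<^sub>R (z i - snd (d i))"
        unfolding Suc by (simp add: scaleR_diff_right)
      also have "(1/2)^i *\<^sub>R snd (d 0) - (1/2)^Suc i *\<^sub>R snd (d 0) = (1/2)^Suc i *\<^sub>R snd (d 0)"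
        by (simp add: scaleR_diff_left[symmetric])
      also have "(1/2)^Suc i *\<^sub>R (z i - snd (d i)) = (1/2)^Suc (Suc i) *\<^sub>R z (Suc i)"
        by (simp add: zS d_def)
      finally show ?case .
    qed
    have limU: "(\<lambda>i. N (snd (s i) - u)) \<longlonglongrightarrow> 0"
    proof (rule tendsto_sandwich)
      show "eventually (\<lambda>i. 0 \<le> N (snd (s i) - u)) sequentially"
        using sD DK uK by (intro always_eventually allI K.N_nonneg K.diff_mem) auto
      have "N (snd (s i) - u) \<le> (1/2)^i * (N (snd (d 0)) + \<rho>)" for i
      proof -
        have "N (snd (s i) - u) \<le> (1/2)^i * N (snd (d 0)) + (1/2)^Suc i * N (z i)"
          unfolding resid using K.N_diff_le[of "(1/2)^i *\<^sub>R snd (d 0)" "(1/2)^Suc i *\<^sub>R z i"] zK[of i] DK(1)[OF dD[of 0]]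
          by (simp add: K.scale_mem K.N_scale)
        also have "(1/2)^Suc i * N (z i) \<le> (1/2)^i * \<rho>"
          using zK[of i] K.N_nonneg[of "z i"] by (intro mult_mono) auto
        finally show ?thesis by (simp add: distrib_left)
      qed
      then show "eventually (\<lambda>i. N (snd (s i) - u) \<le> (1/2)^i * (N (snd (d 0)) + \<rho>)) sequentially"
        by simp
      have "(\<lambda>i. (1/2)^i * (N (snd (d 0)) + \<rho>)) \<longlonglongrightarrow> 0 * (N (snd (d 0)) + \<rho>)"
        by (intro tendsto_mult tendsto_const LIMSEQ_power_zero) simp
      then show "(\<lambda>i. (1/2)^i * (N (snd (d 0)) + \<rho>)) \<longlonglongrightarrow> 0" by simp
    qed simp
    obtain B where B: "\<And>d. d \<in> D m \<Longrightarrow> R (fst d) \<le> B" using bounded[of m] by fastforce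
    have "\<exists>x\<in>W. (\<lambda>i. R (fst (s i) - x)) \<longlonglongrightarrow> 0"
    proof (rule W.geometric_convergent)
      show "fst (s i) \<in> W" for i using DK sD by blast
      show "R (fst (s (Suc i)) - fst (s i)) \<le> B * (1/2)^i" for i
      proof -
        have dW: "fst (d i) \<in> W" "fst (d 0) \<in> W" using DK dD by blast+
        have "R (fst (s (Suc i)) - fst (s i)) = (1/2)^Suc i * R (fst (d i) - fst (d 0))"
          using W.N_scale[of "fst (d i) - fst (d 0)" "(1/2)^Suc i"] dW by (simp add: sS W.diff_mem)
        also have "\<dots> \<le> (1/2)^Suc i * (B + B)"
          using W.N_diff_le[OF dW] B[OF dD[of i]] B[OF dD[of 0]] by (intro mult_left_mono) auto
        finally show ?thesis by (simp add: mult.commute)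
      qed
    qed
    then obtain x where x: "x \<in> W" "(\<lambda>i. R (fst (s i) - x)) \<longlonglongrightarrow> 0" by blast
    have "(x, u) \<in> D m"
      by (rule closed[OF _ x(1) uK x(2) limU]) (simp only: prod.collapse sD)
    then show ?thesis by blast
  qed
  show thesis
  proof (rule that[OF _ half])
    show "0 < \<rho> / 2" using \<rho> by simp
  qed
qed

section \<open>Weighted spaces of continuous functions are complete\<close>

text \<open>
  Pointwise scalar multiplication makes every type of vector-valued functions a real vector space,
  of which the weighted spaces are subspaces.
\<close>

instantiation "fun" :: (type, scaleR) scaleR
begin
definition scaleR_fun_def: "a *\<^sub>R f = (\<lambda>x. a *\<^sub>R f x)"
instance ..
end

lemma scaleR_fun_apply [simp]: "(a *\<^sub>R f) x = a *\<^sub>R f x"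
  by (simp add: scaleR_fun_def)

instance "fun" :: (type, real_vector) real_vector
  by standard (simp_all add: fun_eq_iff algebra_simps)

lemmas fun_ops = plus_fun_def fun_diff_def scaleR_fun_def zero_fun_def fun_Compl_def

text \<open>The standing assumptions on the scaling functions.\<close>

definition weight :: "'p topology \<Rightarrow> ('p \<Rightarrow> real) \<Rightarrow> bool" where
  "weight X \<psi> \<longleftrightarrow> continuous_map X euclideanreal \<psi> \<and> (\<forall>s\<in>topspace X. 1 \<le> \<psi> s)"

lemma weight_pos: "weight X \<psi> \<Longrightarrow> s \<in> topspace X \<Longrightarrow> 0 < \<psi> s"
  unfolding weight_def by force

lemma norm_div_weight_le_iff:
  assumes "weight X \<psi>" "s \<in> topspace X"
  shows "norm (x s /\<^sub>R \<psi> s) \<le> B \<longleftrightarrow> norm (x s) \<le> B * \<psi> s"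
  using weight_pos[OF assms] by (simp add: field_simps)

lemma weighted_spaceI:
  assumes w: "weight X \<psi>" and cont: "continuous_map X euclidean x"
    and off: "\<And>s. s \<notin> topspace X \<Longrightarrow> x s = 0"
    and le: "\<And>s. s \<in> topspace X \<Longrightarrow> norm (x s) \<le> B * \<psi> s"
  shows "x \<in> weighted_space X \<psi>"
proof -
  have "continuous_map X euclidean (\<lambda>s. x s /\<^sub>R \<psi> s)"
    using w cont weight_pos[OF w] unfolding continuous_map_atin weight_def
    by (auto intro!: tendsto_scaleR tendsto_inverse)
  moreover have "bounded ((\<lambda>s. x s /\<^sub>R \<psi> s) ` topspace X)"
    unfolding bounded_iff using le norm_div_weight_le_iff[OF w] by (intro exI[of _ B]) blast
  ultimately show ?thesis
    using cont off by (simp add: weighted_space_def bcont_space_def cont_space_def)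
qed

lemma weighted_norm_upper:
  assumes w: "weight X \<psi>" and x: "x \<in> weighted_space X \<psi>" and s: "s \<in> topspace X"
  shows "norm (x s) \<le> weighted_norm X \<psi> x * \<psi> s"
proof -
  obtain B where B: "\<And>s. s \<in> topspace X \<Longrightarrow> norm (x s /\<^sub>R \<psi> s) \<le> B"
    using weighted_space_bound[OF x] by blast
  then have "bdd_above (insert 0 ((\<lambda>s. norm (x s /\<^sub>R \<psi> s)) ` topspace X))"
    unfolding bdd_above_insert by (intro bdd_aboveI2)
  then have "norm (x s /\<^sub>R \<psi> s) \<le> weighted_norm X \<psi> x"
    unfolding weighted_norm_def sup_norm_def using s by (intro cSup_upper) auto
  then show ?thesis by (simp only: norm_div_weight_le_iff[OF w s])
qed

lemma weighted_norm_least: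
  assumes w: "weight X \<psi>" and "0 \<le> r" and le: "\<And>s. s \<in> topspace X \<Longrightarrow> norm (x s) \<le> r * \<psi> s"
  shows "weighted_norm X \<psi> x \<le> r"
  unfolding weighted_norm_def sup_norm_def
proof (rule cSup_least)
  fix z assume "z \<in> insert 0 ((\<lambda>s. norm (x s /\<^sub>R \<psi> s)) ` topspace X)"
  then show "z \<le> r" using assms(2) le norm_div_weight_le_iff[OF w] by blast
qed simp

lemma weighted_norm_eq_dist:
  assumes "x \<in> weighted_space X \<psi>" "y \<in> weighted_space X \<psi>"
  shows "weighted_dist X \<psi> x y = weighted_norm X \<psi> (x - y)"
  using assms by (simp add: weighted_dist_def fun_diff_def)

lemma weighted_space_continuous: "x \<in> weighted_space X \<psi> \<Longrightarrow> continuous_map X euclidean x"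
  by (simp add: weighted_space_def cont_space_def)

lemma weighted_space_off: "x \<in> weighted_space X \<psi> \<Longrightarrow> s \<notin> topspace X \<Longrightarrow> x s = 0"
  by (simp add: weighted_space_def cont_space_def)

lemma seminormed_weighted_space:
  assumes w: "weight X \<psi>"
  shows "seminormed_subspace (weighted_space X \<psi>) (weighted_norm X \<psi> :: ('p \<Rightarrow> real^'d) \<Rightarrow> real)"
proof
  let ?V = "weighted_space X \<psi> :: ('p \<Rightarrow> real^'d) set" and ?N = "weighted_norm X \<psi>"
  have zero: "0 \<in> ?V" by (rule weighted_spaceI[OF w, of _ 0]) (auto simp: zero_fun_def)
  have nonneg: "0 \<le> ?N x" if x: "x \<in> ?V" for x
    using weighted_dist_nonneg[of X \<psi> x 0] that zero by (simp add: weighted_norm_eq_dist)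
  have add_le: "norm ((x + y) s) \<le> (?N x + ?N y) * \<psi> s" if "x \<in> ?V" "y \<in> ?V" "s \<in> topspace X" for x y s
    using norm_triangle_ineq[of "x s" "y s"] weighted_norm_upper[OF w that(1,3)]
      weighted_norm_upper[OF w that(2,3)] by (simp add: distrib_right)
  have add: "x + y \<in> ?V" if x: "x \<in> ?V" and y: "y \<in> ?V" for x y
  proof (rule weighted_spaceI[OF w _ _ add_le[OF x y]])
    show "continuous_map X euclidean (x + y)"
      using weighted_space_continuous[OF x] weighted_space_continuous[OF y]
      unfolding continuous_map_atin plus_fun_def by (auto intro: tendsto_add)
  qed (use weighted_space_off[OF x] weighted_space_off[OF y] in auto)
  have scale_le: "norm ((a *\<^sub>R x) s) \<le> (\<bar>a\<bar> * ?N x) * \<psi> s" if "x \<in> ?V" "s \<in> topspace X" for x s a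
    using mult_left_mono[OF weighted_norm_upper[OF w that], of "\<bar>a\<bar>"] by (simp add: mult.assoc)
  have scale: "a *\<^sub>R x \<in> ?V" if x: "x \<in> ?V" for x a
  proof (rule weighted_spaceI[OF w _ _ scale_le[OF x]])
    show "continuous_map X euclidean (a *\<^sub>R x)"
      using weighted_space_continuous[OF x]
      unfolding continuous_map_atin scaleR_fun_def by (auto intro: tendsto_scaleR)
  qed (use weighted_space_off[OF x] in auto)
  show "subspace ?V" unfolding subspace_def using zero add scale by blast
  show "?N (x + y) \<le> ?N x + ?N y" if "x \<in> ?V" "y \<in> ?V" for x y
    by (rule weighted_norm_least[OF w _ add_le[OF that]]) (simp_all add: nonneg that)
  have scaleN: "?N (a *\<^sub>R x) \<le> \<bar>a\<bar> * ?N x" if x: "x \<in> ?V" for a x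
    by (rule weighted_norm_least[OF w _ scale_le[OF x]]) (simp_all add: nonneg x)
  show "?N (a *\<^sub>R x) = \<bar>a\<bar> * ?N x" if x: "x \<in> ?V" for a x
  proof (cases "a = 0")
    case True
    then show ?thesis using scaleN[OF x, of 0] nonneg[OF scale[OF x, of 0]] by simp
  next
    case False
    have "?N (inverse a *\<^sub>R (a *\<^sub>R x)) \<le> \<bar>inverse a\<bar> * ?N (a *\<^sub>R x)"
      by (rule scaleN[OF scale[OF x]])
    then have "\<bar>a\<bar> * ?N x \<le> ?N (a *\<^sub>R x)" using False by (simp add: field_simps)
    with scaleN[OF x, of a] show ?thesis by simp
  qed
qed

lemma weighted_norm_definite:
  assumes w: "weight X \<psi>" and x: "x \<in> weighted_space X \<psi>" and 0: "weighted_norm X \<psi> x = 0"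
  shows "x = 0"
proof
  fix s show "x s = 0 s"
    using weighted_norm_upper[OF w x, of s] weighted_space_off[OF x, of s] 0
    by (cases "s \<in> topspace X") auto
qed

text \<open>
  A Cauchy sequence converges pointwise, and uniformly after division by \<open>\<psi>\<close>. As \<open>\<psi>\<close> is locally
  bounded, the convergence is locally uniform, so that the limit is continuous.
\<close>

lemma complete_weighted_space:
  assumes w: "weight X \<psi>"
  shows "complete_seminormed_subspace (weighted_space X \<psi>) (weighted_norm X \<psi> :: ('p \<Rightarrow> real^'d) \<Rightarrow> real)"
proof -
  let ?V = "weighted_space X \<psi> :: ('p \<Rightarrow> real^'d) set" and ?N = "weighted_norm X \<psi>"
  interpret seminormed_subspace ?V ?N by (rule seminormed_weighted_space[OF w])
  show ?thesis
  proof
    fix x :: "nat \<Rightarrow> 'p \<Rightarrow> real^'d"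
    assume x: "\<And>n. x n \<in> ?V" and cauchy: "\<And>e. 0 < e \<Longrightarrow> \<exists>k. \<forall>m\<ge>k. \<forall>n\<ge>k. ?N (x m - x n) < e"
    have pt: "norm (x m s - x n s) \<le> ?N (x m - x n) * \<psi> s" if "s \<in> topspace X" for m n s
      using weighted_norm_upper[OF w diff_mem[OF x x] that] by simp
    have "convergent (\<lambda>n. x n s)" for s
    proof (cases "s \<in> topspace X")
      case True
      have "Cauchy (\<lambda>n. x n s)"
        unfolding Cauchy_def dist_norm
      proof (intro allI impI)
        fix e :: real assume "0 < e"
        then obtain k where k: "\<forall>m\<ge>k. \<forall>n\<ge>k. ?N (x m - x n) < e / \<psi> s"
          using cauchy[of "e / \<psi> s"] weight_pos[OF w True] by auto
        have "norm (x m s - x n s) < e" if "k \<le> m" "k \<le> n" for m n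
        proof -
          have "?N (x m - x n) * \<psi> s < (e / \<psi> s) * \<psi> s"
            using k that weight_pos[OF w True] by (intro mult_strict_right_mono) auto
          with pt[OF True, of m n] show ?thesis using weight_pos[OF w True] by simp
        qed
        then show "\<exists>M. \<forall>m\<ge>M. \<forall>n\<ge>M. norm (x m s - x n s) < e" by blast
      qed
      then show ?thesis by (rule Cauchy_convergent)
    next
      case False
      then have "(\<lambda>n. x n s) = (\<lambda>n. 0)" using weighted_space_off[OF x] by auto
      then show ?thesis by (simp add: convergent_const)
    qed
    then obtain l where l: "\<And>s. (\<lambda>n. x n s) \<longlonglongrightarrow> l s"
      unfolding convergent_def by metis
    have off: "l s = 0" if "s \<notin> topspace X" for s
      using LIMSEQ_unique[OF l, of s 0] weighted_space_off[OF x that] by simp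
    have unif: "\<exists>k. \<forall>n\<ge>k. \<forall>s\<in>topspace X. norm (x n s - l s) \<le> e * \<psi> s" if e: "0 < e" for e
    proof -
      obtain k where k: "\<forall>m\<ge>k. \<forall>n\<ge>k. ?N (x m - x n) < e" using cauchy[OF e] by blast
      have "norm (x n s - l s) \<le> e * \<psi> s" if n: "k \<le> n" and s: "s \<in> topspace X" for n s
      proof (rule LIMSEQ_le_const2)
        show "(\<lambda>m. norm (x n s - x m s)) \<longlonglongrightarrow> norm (x n s - l s)"
          by (intro tendsto_intros l)
        have "norm (x n s - x m s) \<le> e * \<psi> s" if "k \<le> m" for m
        proof -
          have "?N (x n - x m) * \<psi> s \<le> e * \<psi> s"
            using k n that weight_pos[OF w s] by (intro mult_right_mono) (auto intro: less_imp_le)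
          with pt[OF s, of n m] show ?thesis by linarith
        qed
        then show "\<exists>k. \<forall>m\<ge>k. norm (x n s - x m s) \<le> e * \<psi> s" by blast
      qed
      then show ?thesis by blast
    qed
    have "continuous_map X euclidean l"
      unfolding continuous_map_atin
    proof
      fix s assume s: "s \<in> topspace X"
      have "(l \<longlongrightarrow> l s) (atin X s)"
      proof (rule tendstoI)
        fix e :: real assume e: "0 < e"
        define \<delta> where "\<delta> = (e / 3) / (\<psi> s + 1)"
        have \<psi>s: "0 < \<psi> s + 1" using weight_pos[OF w s] by simp
        then have \<delta>: "0 < \<delta>" "\<delta> * (\<psi> s + 1) = e / 3"
          using e iffD1[OF nonzero_eq_divide_eq \<delta>_def] by (simp_all add: \<delta>_def)
        obtain n where n: "\<And>t. t \<in> topspace X \<Longrightarrow> norm (x n t - l t) \<le> \<delta> * \<psi> t"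
          using unif[OF \<delta>(1)] by blast
        have "(\<psi> \<longlongrightarrow> \<psi> s) (atin X s)" "(x n \<longlongrightarrow> x n s) (atin X s)"
          using w weighted_space_continuous[OF x[of n]] s by (auto simp: weight_def continuous_map_atin)
        then have "\<forall>\<^sub>F t in atin X s. \<psi> t < \<psi> s + 1" "\<forall>\<^sub>F t in atin X s. dist (x n t) (x n s) < e / 3"
          using order_tendstoD(2)[of \<psi> "\<psi> s" "atin X s" "\<psi> s + 1"] tendstoD[of "x n" "x n s" "atin X s" "e / 3"] e
          by simp_all
        then show "\<forall>\<^sub>F t in atin X s. dist (l t) (l s) < e"
        proof eventually_elim
          case (elim t)
          have near: "norm (x n t - l t) \<le> e / 3" if "\<psi> t < \<psi> s + 1" for t
          proof (cases "t \<in> topspace X")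
            case True
            have "\<delta> * \<psi> t \<le> \<delta> * (\<psi> s + 1)" using that \<delta>(1) by (intro mult_left_mono) auto
            with n[OF True] \<delta>(2) show ?thesis by linarith
          next
            case False
            then show ?thesis using off weighted_space_off[OF x] e by simp
          qed
          have "dist (l t) (l s) \<le> dist (l t) (x n t) + dist (x n t) (x n s) + dist (x n s) (l s)"
            using dist_triangle[of "l t" "l s" "x n t"] dist_triangle[of "x n t" "l s" "x n s"] by linarith
          then show ?case
            using elim near[of t] near[of s] by (simp add: dist_norm norm_minus_commute)
        qed
      qed
      then show "limitin euclidean l (l s) (atin X s)" by simp
    qed
    moreover obtain k where k: "\<forall>s\<in>topspace X. norm (x k s - l s) \<le> 1 * \<psi> s"
      using unif[of 1] by auto
    moreover have "norm (l s) \<le> (?N (x k) + 1) * \<psi> s" if s: "s \<in> topspace X" for s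
      using norm_triangle_ineq4[of "x k s" "x k s - l s"] k[rule_format, OF s] weighted_norm_upper[OF w x s, of k]
      by (simp add: distrib_right)
    ultimately have lV: "l \<in> ?V" using off by (intro weighted_spaceI[OF w]) auto
    have "(\<lambda>n. ?N (x n - l)) \<longlonglongrightarrow> 0"
    proof (rule LIMSEQ_I)
      fix e :: real assume e: "0 < e"
      obtain k where k: "\<And>n s. k \<le> n \<Longrightarrow> s \<in> topspace X \<Longrightarrow> norm (x n s - l s) \<le> (e / 2) * \<psi> s"
        using unif[of "e / 2"] e by auto
      have "?N (x n - l) \<le> e / 2" if "k \<le> n" for n
        using k[OF that] e by (intro weighted_norm_least[OF w]) auto
      then show "\<exists>k. \<forall>n\<ge>k. norm (?N (x n - l) - 0) < e"
        using e N_nonneg[OF diff_mem[OF x lV]] by (intro exI[of _ k]) force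
    qed
    with lV show "\<exists>l\<in>?V. (\<lambda>n. ?N (x n - l)) \<longlonglongrightarrow> 0" by blast
  qed
qed

lemma Metric_space_weight: "weight X \<psi> \<Longrightarrow> Metric_space (weighted_space X \<psi>) (weighted_dist X \<psi>)"
  by (rule Metric_space_weighted) (rule weight_pos)

lemma closedin_weighted_sequentially:
  assumes w: "weight X \<psi>" and A: "closedin (weighted_topology X \<psi>) A"
    and x: "\<And>n. x n \<in> A" and l: "l \<in> weighted_space X \<psi>"
    and lim: "(\<lambda>n. weighted_norm X \<psi> (x n - l)) \<longlonglongrightarrow> 0"
  shows "l \<in> A"
proof -
  interpret Metric_space "weighted_space X \<psi>" "weighted_dist X \<psi>"
    by (rule Metric_space_weight[OF w])
  have A': "closedin mtopology A" using A by (simp add: weighted_topology_def)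
  have xV: "x n \<in> weighted_space X \<psi>" for n using closedin_subset[OF A'] x by auto
  have "limitin mtopology x l sequentially"
    unfolding limitin_metric
  proof (intro conjI allI impI l)
    fix e :: real assume "0 < e"
    then have "eventually (\<lambda>n. weighted_norm X \<psi> (x n - l) < e) sequentially"
      by (rule order_tendstoD(2)[OF lim])
    then show "\<forall>\<^sub>F n in sequentially. x n \<in> weighted_space X \<psi> \<and> weighted_dist X \<psi> (x n) l < e"
      by (rule eventually_mono) (simp add: xV l weighted_norm_eq_dist)
  qed
  then show ?thesis using A' x unfolding metric_closedin_iff_sequentially_closed by blast
qed

lemma weighted_dual_iff:
  "l \<in> weighted_dual X \<psi> \<longleftrightarrow>
     linear_on (weighted_space X \<psi>) l \<and> continuous_map (weighted_topology X \<psi>) euclideanreal l"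
  by (auto simp: weighted_dual_def linear_on_def fun_ops)

lemma bounded_linear_on_in_weighted_dual:
  fixes l :: "('p \<Rightarrow> real^'d) \<Rightarrow> real"
  assumes w: "weight X \<psi>" and l: "linear_on (weighted_space X \<psi>) l"
    and M: "\<And>x. x \<in> weighted_space X \<psi> \<Longrightarrow> l x \<le> M * weighted_norm X \<psi> x"
  shows "l \<in> weighted_dual X \<psi>"
proof -
  let ?V = "weighted_space X \<psi> :: ('p \<Rightarrow> real^'d) set" and ?N = "weighted_norm X \<psi>"
  interpret seminormed_subspace ?V ?N by (rule seminormed_weighted_space[OF w])
  interpret m: Metric_space ?V "weighted_dist X \<psi>" by (rule Metric_space_weight[OF w])
  have lip: "\<bar>l x - l y\<bar> \<le> \<bar>M\<bar> * ?N (x - y)" if x: "x \<in> ?V" and y: "y \<in> ?V" for x y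
  proof -
    have *: "l x - l y \<le> \<bar>M\<bar> * ?N (x - y)" if x: "x \<in> ?V" and y: "y \<in> ?V" for x y
    proof -
      have "l x - l y \<le> M * ?N (x - y)"
        using M[OF diff_mem[OF x y]] linear_on_diff[OF subspace l x y] by simp
      also have "\<dots> \<le> \<bar>M\<bar> * ?N (x - y)"
        by (intro mult_right_mono N_nonneg diff_mem x y) simp
      finally show ?thesis .
    qed
    show ?thesis using *[OF x y] *[OF y x] N_minus_commute[OF x y] by simp
  qed
  have "continuous_map m.mtopology Met_TC.mtopology l"
    unfolding m.metric_continuous_map[OF Met_TC.Metric_space_axioms]
  proof (intro conjI ballI allI impI)
    fix x and e :: real assume x: "x \<in> ?V" and e: "0 < e"
    have "dist (l x) (l y) < e" if y: "y \<in> ?V" "weighted_dist X \<psi> x y < e / (\<bar>M\<bar> + 1)" for y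
    proof -
      have N: "?N (x - y) < e / (\<bar>M\<bar> + 1)" using y x by (simp add: weighted_norm_eq_dist)
      have "\<bar>l x - l y\<bar> \<le> (\<bar>M\<bar> + 1) * ?N (x - y)"
        using lip[OF x y(1)] N_nonneg[OF diff_mem[OF x y(1)]] by (simp add: distrib_right)
      also have "\<dots> < e" using N by (simp add: field_simps)
      finally show ?thesis by (simp add: dist_real_def)
    qed
    then show "\<exists>\<delta>>0. \<forall>y. y \<in> ?V \<and> weighted_dist X \<psi> x y < \<delta> \<longrightarrow> dist (l x) (l y) < e"
      using e by (intro exI[of _ "e / (\<bar>M\<bar> + 1)"]) (auto simp: add_pos_nonneg)
  qed simp
  then show ?thesis
    using l by (simp add: weighted_dual_iff weighted_topology_def mtopology_is_euclidean)
qed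

section \<open>Composition with the coordinate projections\<close>

lemma weight_path:
  assumes w: "\<forall>t\<le>T. weight (X t) (\<psi> t)"
  shows "weight (path_top T X) (path_weight T \<psi>)"
    and "\<And>t s. t \<le> T \<Longrightarrow> s \<in> topspace (path_top T X) \<Longrightarrow> \<psi> t (s t) \<le> path_weight T \<psi> s"
proof -
  have s: "s t \<in> topspace (X t)" if "s \<in> topspace (path_top T X)" "t \<le> T" for s t
    using that by (auto simp: topspace_product_topology)
  have nn: "0 \<le> \<psi> t (s t)" if "s \<in> topspace (path_top T X)" "t \<le> T" for s t
    using weight_pos[OF w[rule_format, OF that(2)] s[OF that]] by simp
  show le: "\<psi> t (s t) \<le> path_weight T \<psi> s" if "t \<le> T" "s \<in> topspace (path_top T X)" for t s
    unfolding path_weight_def using nn that by (intro member_le_sum) auto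
  have "continuous_map (path_top T X) euclideanreal (path_weight T \<psi>)"
    unfolding path_weight_def
  proof (rule continuous_map_sum)
    fix t assume t: "t \<in> {..T}"
    have "continuous_map (path_top T X) euclideanreal (\<psi> t \<circ> (\<lambda>s. s t))"
      using t w by (intro continuous_map_compose[OF continuous_map_product_projection]) (auto simp: weight_def)
    then show "continuous_map (path_top T X) euclideanreal (\<lambda>s. \<psi> t (s t))" by (simp add: o_def)
  qed simp
  moreover have "1 \<le> path_weight T \<psi> s" if "s \<in> topspace (path_top T X)" for s
    using le[of 0 s] s[OF that, of 0] w that by (force simp: weight_def)
  ultimately show "weight (path_top T X) (path_weight T \<psi>)" by (simp add: weight_def)
qed

lemma comp_proj_add: "comp_proj T X t (x + y) = comp_proj T X t x + comp_proj T X t y"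
  by (auto simp: comp_proj_def fun_eq_iff)

lemma comp_proj_scale: "comp_proj T X t (a *\<^sub>R x) = a *\<^sub>R comp_proj T X t x"
  by (auto simp: comp_proj_def fun_eq_iff)

lemma comp_proj_diff: "comp_proj T X t (x - y) = comp_proj T X t x - comp_proj T X t y"
  by (auto simp: comp_proj_def fun_eq_iff)

lemma comp_proj_bounded:
  fixes X :: "nat \<Rightarrow> 'a topology" and x :: "'a \<Rightarrow> real^'d"
  assumes w: "\<forall>t\<le>T. weight (X t) (\<psi> t)" and t: "t \<le> T"
    and x: "x \<in> weighted_space (X t) (\<psi> t)"
  shows "comp_proj T X t x \<in> weighted_space (path_top T X) (path_weight T \<psi>)"
    and "weighted_norm (path_top T X) (path_weight T \<psi>) (comp_proj T X t x) \<le> weighted_norm (X t) (\<psi> t) x"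
proof -
  note wp = weight_path[OF w]
  interpret seminormed_subspace "weighted_space (X t) (\<psi> t) :: ('a \<Rightarrow> real^'d) set" "weighted_norm (X t) (\<psi> t)"
    by (rule seminormed_weighted_space[OF w[rule_format, OF t]])
  let ?N = "weighted_norm (X t) (\<psi> t) x"
  have le: "norm (comp_proj T X t x s) \<le> ?N * path_weight T \<psi> s" if s: "s \<in> topspace (path_top T X)" for s
  proof -
    have "s t \<in> topspace (X t)" using s t by (auto simp: topspace_product_topology)
    then have "norm (x (s t)) \<le> ?N * \<psi> t (s t)" by (rule weighted_norm_upper[OF w[rule_format, OF t] x])
    also have "\<dots> \<le> ?N * path_weight T \<psi> s"
      by (intro mult_left_mono wp(2) t s N_nonneg x)
    finally show ?thesis using s by (simp add: comp_proj_def)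
  qed
  show "comp_proj T X t x \<in> weighted_space (path_top T X) (path_weight T \<psi>)"
  proof (rule weighted_spaceI[OF wp(1) _ _ le])
    have "continuous_map (path_top T X) euclidean (x \<circ> (\<lambda>s. s t))"
      using t weighted_space_continuous[OF x]
      by (intro continuous_map_compose[OF continuous_map_product_projection]) auto
    then show "continuous_map (path_top T X) euclidean (comp_proj T X t x)"
      by (rule continuous_map_eq) (simp add: comp_proj_def)
  next
    fix s assume "s \<notin> topspace (path_top T X)"
    then show "comp_proj T X t x s = 0"
      by (simp only: comp_proj_def if_False)
  qed
  show "weighted_norm (path_top T X) (path_weight T \<psi>) (comp_proj T X t x) \<le> ?N"
    by (rule weighted_norm_least[OF wp(1) N_nonneg[OF x] le])
qed

lemma marginal_in_weighted_dual:
  fixes X :: "nat \<Rightarrow> 'a topology" and l :: "((nat \<Rightarrow> 'a) \<Rightarrow> real^'d) \<Rightarrow> real"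
  assumes w: "\<forall>t\<le>T. weight (X t) (\<psi> t)" and t: "t \<le> T"
    and l: "l \<in> weighted_dual (path_top T X) (path_weight T \<psi>)"
  shows "marginal T X t l \<in> weighted_dual (X t) (\<psi> t)"
proof -
  let ?V = "weighted_space (path_top T X) (path_weight T \<psi>) :: ((nat \<Rightarrow> 'a) \<Rightarrow> real^'d) set"
    and ?C = "weighted_space (X t) (\<psi> t) :: ('a \<Rightarrow> real^'d) set"
  note wp = weight_path[OF w]
  note comp = comp_proj_bounded[OF w t]
  interpret seminormed_subspace ?C "weighted_norm (X t) (\<psi> t)"
    by (rule seminormed_weighted_space[OF w[rule_format, OF t]])
  interpret m: Metric_space ?C "weighted_dist (X t) (\<psi> t)" by (rule Metric_space_weight[OF w[rule_format, OF t]])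
  have m': "Metric_space ?V (weighted_dist (path_top T X) (path_weight T \<psi>))"
    by (rule Metric_space_weight[OF wp(1)])
  have "continuous_map (weighted_topology (X t) (\<psi> t)) (weighted_topology (path_top T X) (path_weight T \<psi>))
      (comp_proj T X t :: ('a \<Rightarrow> real^'d) \<Rightarrow> _)"
    unfolding weighted_topology_def m.metric_continuous_map[OF m']
  proof (intro conjI ballI allI impI)
    show "comp_proj T X t ` ?C \<subseteq> ?V" using comp(1) by blast
    fix x :: "'a \<Rightarrow> real^'d" and e :: real assume x: "x \<in> ?C" and e: "0 < e"
    have "weighted_dist (path_top T X) (path_weight T \<psi>) (comp_proj T X t x) (comp_proj T X t y)
        \<le> weighted_dist (X t) (\<psi> t) x y" if y: "y \<in> ?C" for y
      using comp(2)[OF diff_mem[OF x y]] comp(1)[OF x] comp(1)[OF y] x y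
      by (simp add: weighted_norm_eq_dist comp_proj_diff)
    then show "\<exists>\<delta>>0. \<forall>y. y \<in> ?C \<and> weighted_dist (X t) (\<psi> t) x y < \<delta> \<longrightarrow>
        weighted_dist (path_top T X) (path_weight T \<psi>) (comp_proj T X t x) (comp_proj T X t y) < e"
      using e by (intro exI[of _ e]) force
  qed
  moreover have "linear_on ?V l" "continuous_map (weighted_topology (path_top T X) (path_weight T \<psi>)) euclideanreal l"
    using l by (simp_all add: weighted_dual_iff)
  ultimately have "continuous_map (weighted_topology (X t) (\<psi> t)) euclideanreal (l \<circ> comp_proj T X t)"
    by (intro continuous_map_compose)
  moreover have "linear_on ?C (marginal T X t l)"
    using linear_on_add[OF \<open>linear_on ?V l\<close> comp(1) comp(1)] linear_on_scale[OF \<open>linear_on ?V l\<close> comp(1)]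
    by (simp add: linear_on_def marginal_def comp_proj_add comp_proj_scale)
  moreover have "l \<circ> comp_proj T X t = marginal T X t l" by (simp add: fun_eq_iff marginal_def)
  ultimately show ?thesis by (simp add: weighted_dual_iff)
qed

section \<open>The primal and dual problems through the value function\<close>

lemma add_le_of_real_below:
  fixes f g :: ereal
  assumes "f \<noteq> -\<infinity>" "g \<noteq> -\<infinity>" and le: "\<And>b. ereal b < f \<Longrightarrow> ereal b + g \<le> c"
  shows "f + g \<le> c"
proof (cases g)
  case PInf
  obtain b where "ereal b < f" using assms(1) by (metis ereal_dense2 ereal_infty_less(2) MInfty_neq_ereal(1) less_ereal.simps(6) ereal_less_eq(2) not_less antisym)
  then show ?thesis using le PInf by fastforce
next
  case MInf then show ?thesis using assms by simp
next
  case (real r)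
  show ?thesis
  proof (rule dense_le)
    fix y assume y: "y < f + g"
    show "y \<le> c"
    proof (cases y)
      case (real z)
      then have "ereal (z - r) < f" using y \<open>g = ereal r\<close> by (cases f) auto
      then show ?thesis using le[of "z - r"] real \<open>g = ereal r\<close> by simp
    qed (use y in auto)
  qed
qed

lemma sum_not_MInf:
  fixes f :: "'i \<Rightarrow> ereal"
  assumes "\<And>i. i \<in> I \<Longrightarrow> f i \<noteq> -\<infinity>"
  shows "(\<Sum>i\<in>I. f i) \<noteq> -\<infinity>"
  using assms by (induction I rule: infinite_finite_induct) auto

lemma sum_le_of_real_below:
  fixes f :: "'i \<Rightarrow> ereal"
  assumes "finite I" "\<And>i. i \<in> I \<Longrightarrow> f i \<noteq> -\<infinity>"
    and "\<And>a. (\<And>i. i \<in> I \<Longrightarrow> ereal (a i) < f i) \<Longrightarrow> ereal (\<Sum>i\<in>I. a i) \<le> c"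
  shows "(\<Sum>i\<in>I. f i) \<le> c"
  using assms
proof (induction I arbitrary: c rule: finite_induct)
  case empty
  then show ?case by (simp add: zero_ereal_def)
next
  case (insert j I)
  have "f j + (\<Sum>i\<in>I. f i) \<le> c"
  proof (rule add_le_of_real_below)
    show "(\<Sum>i\<in>I. f i) \<noteq> -\<infinity>" using insert.prems by (intro sum_not_MInf) auto
    fix b assume b: "ereal b < f j"
    have "(\<Sum>i\<in>I. f i) \<le> c - ereal b"
    proof (rule insert.IH)
      fix a assume a: "\<And>i. i \<in> I \<Longrightarrow> ereal (a i) < f i"
      let ?a = "a(j := b)"
      have "ereal (\<Sum>i\<in>insert j I. ?a i) \<le> c"
        using a b by (intro insert.prems(2)) auto
      moreover have "(\<Sum>i\<in>I. ?a i) = (\<Sum>i\<in>I. a i)"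
        using insert.hyps by (intro sum.cong) auto
      ultimately have "ereal (b + (\<Sum>i\<in>I. a i)) \<le> c" using insert.hyps by simp
      then show "ereal (\<Sum>i\<in>I. a i) \<le> c - ereal b" by (cases c) auto
    qed (use insert.prems in auto)
    then show "ereal b + (\<Sum>i\<in>I. f i) \<le> c"
      by (simp add: ereal_le_minus add.commute)
  qed (use insert.prems in auto)
  then show ?case using insert.hyps by simp
qed

lemma less_ereal_minusD:
  assumes "ereal a < ereal b - f" "f \<noteq> -\<infinity>"
  obtains g where "f = ereal g" "a < b - g"
  using assms by (cases f) auto

lemma sum_fun_upd:
  fixes f :: "nat \<Rightarrow> 'b \<Rightarrow> real"
  assumes "t \<le> T"
  shows "(\<Sum>s\<le>T. f s ((x(t := y)) s)) = (\<Sum>s\<le>T. f s (x s)) - f t (x t) + f t y"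
proof -
  have "(\<Sum>s\<le>T. f s ((x(t := y)) s)) = f t y + (\<Sum>s\<in>{..T} - {t}. f s ((x(t := y)) s))"
    using assms by (subst sum.remove[of _ t]) auto
  also have "(\<Sum>s\<in>{..T} - {t}. f s ((x(t := y)) s)) = (\<Sum>s\<in>{..T} - {t}. f s (x s))"
    by (intro sum.cong) auto
  also have "\<dots> = (\<Sum>s\<le>T. f s (x s)) - f t (x t)"
    using assms by (simp add: sum_diff1)
  finally show ?thesis by simp
qed

lemma conjugate_not_MInf: "proper_fun Y w f \<Longrightarrow> conjugate Y w f l \<noteq> -\<infinity>"
proof -
  assume "proper_fun Y w f"
  then obtain x where x: "x \<in> weighted_space Y w" "f x < \<infinity>" "f x > -\<infinity>"
    unfolding proper_fun_def by blast
  then obtain r where "f x = ereal r" by (cases "f x") auto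
  then have "ereal (l x - r) \<le> conjugate Y w f l"
    unfolding conjugate_def using x by (intro SUP_upper2[of x]) auto
  then show ?thesis by auto
qed

text \<open>One half of the equality case of the Fenchel--Young inequality.\<close>

lemma subgradient_conjugate:
  assumes w: "weight Y w" and f: "proper_fun Y w f" and l: "l \<in> subdifferential Y w f x"
    and x: "x \<in> weighted_space Y w"
  obtains r where "f x = ereal r" "conjugate Y w f l \<le> ereal (l x - r)"
proof -
  interpret seminormed_subspace "weighted_space Y w" "weighted_norm Y w" by (rule seminormed_weighted_space[OF w])
  have ld: "linear_on (weighted_space Y w) l"
    and sub: "\<And>y. y \<in> weighted_space Y w \<Longrightarrow> f x + ereal (l (\<lambda>s. y s - x s)) \<le> f y"
    using l by (auto simp: subdifferential_def weighted_dual_iff)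
  obtain y where "y \<in> weighted_space Y w" "f y < \<infinity>" using f by (auto simp: proper_fun_def)
  with sub[of y] have "f x \<noteq> \<infinity>" by auto
  moreover have "f x \<noteq> -\<infinity>" using f x by (auto simp: proper_fun_def)
  ultimately obtain r where r: "f x = ereal r" by (cases "f x") auto
  have "ereal (l y) - f y \<le> ereal (l x - r)" if y: "y \<in> weighted_space Y w" for y
  proof (cases "f y")
    case (real q)
    have "l (\<lambda>s. y s - x s) = l y - l x"
      using linear_on_diff[OF subspace ld y x] by (simp add: fun_diff_def)
    then show ?thesis using sub[OF y] real r by simp
  next
    case MInf
    then show ?thesis using f y by (auto simp: proper_fun_def)
  qed simp
  then have "conjugate Y w f l \<le> ereal (l x - r)"
    unfolding conjugate_def by (intro SUP_least)
  with r show thesis using that by blast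
qed

text \<open>
  The data of the two problems, without convexity, lower semicontinuity and the constraint
  qualification. \<open>C t\<close> and \<open>V\<close> are the spaces of the primal variables and of the perturbations.
\<close>

locale primal_dual_setting =
  fixes T :: nat and X :: "nat \<Rightarrow> 'a topology" and \<psi> :: "nat \<Rightarrow> 'a \<Rightarrow> real"
    and G :: "nat \<Rightarrow> ('a \<Rightarrow> real^'d) \<Rightarrow> ereal"
    and H :: "((nat \<Rightarrow> 'a) \<Rightarrow> real^'d) \<Rightarrow> ereal"
  assumes weights: "\<forall>t\<le>T. weight (X t) (\<psi> t)"
    and G_proper: "\<And>t. t \<le> T \<Longrightarrow> proper_fun (X t) (\<psi> t) (G t)"
    and H_proper: "proper_fun (path_top T X) (path_weight T \<psi>) H"
begin

abbreviation C :: "nat \<Rightarrow> ('a \<Rightarrow> real^'d) set" where "C t \<equiv> weighted_space (X t) (\<psi> t)"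
abbreviation V :: "((nat \<Rightarrow> 'a) \<Rightarrow> real^'d) set" where "V \<equiv> weighted_space (path_top T X) (path_weight T \<psi>)"
abbreviation NC :: "nat \<Rightarrow> ('a \<Rightarrow> real^'d) \<Rightarrow> real" where "NC t \<equiv> weighted_norm (X t) (\<psi> t)"
abbreviation NV :: "((nat \<Rightarrow> 'a) \<Rightarrow> real^'d) \<Rightarrow> real" where "NV \<equiv> weighted_norm (path_top T X) (path_weight T \<psi>)"

text \<open>
  The product of the spaces \<open>C t\<close>. The components beyond \<open>T\<close> are left free instead of being fixed to
  a default value, so that \<open>W\<close> is a subspace and \<open>NW\<close> only a seminorm; nothing below depends on
  these components.
\<close>

definition W :: "(nat \<Rightarrow> 'a \<Rightarrow> real^'d) set" where "W = {x. \<forall>t\<le>T. x t \<in> C t}"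
definition NW :: "(nat \<Rightarrow> 'a \<Rightarrow> real^'d) \<Rightarrow> real" where "NW x = (\<Sum>t\<le>T. NC t (x t))"

text \<open>The sum of the \<open>x\<^sub>t \<circ> \<pi>\<^sub>t\<close>.\<close>

definition A :: "(nat \<Rightarrow> 'a \<Rightarrow> real^'d) \<Rightarrow> (nat \<Rightarrow> 'a) \<Rightarrow> real^'d" where
  "A x = (\<lambda>s. \<Sum>t\<le>T. comp_proj T X t (x t) s)"

text \<open>The perturbed objective and its infimum, the optimum value function.\<close>

definition F :: "(nat \<Rightarrow> 'a \<Rightarrow> real^'d) \<Rightarrow> ((nat \<Rightarrow> 'a) \<Rightarrow> real^'d) \<Rightarrow> ereal" where
  "F x u = (\<Sum>t\<le>T. G t (x t)) + H (u - A x)"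

definition \<phi> :: "((nat \<Rightarrow> 'a) \<Rightarrow> real^'d) \<Rightarrow> ereal" where "\<phi> u = (INF x\<in>W. F x u)"

lemma weightV: "weight (path_top T X) (path_weight T \<psi>)" by (rule weight_path(1)[OF weights])

lemma weightC: "t \<le> T \<Longrightarrow> weight (X t) (\<psi> t)" using weights by blast

sublocale V: complete_seminormed_subspace V NV by (rule complete_weighted_space[OF weightV])

lemma C_complete: "t \<le> T \<Longrightarrow> complete_seminormed_subspace (C t) (NC t)"
  by (rule complete_weighted_space[OF weightC])

lemma C_seminormed: "t \<le> T \<Longrightarrow> seminormed_subspace (C t) (NC t)"
  by (rule seminormed_weighted_space[OF weightC])

lemma seminormed_W: "seminormed_subspace W NW"
proof
  note C = seminormed_subspace.zero_mem[OF C_seminormed] seminormed_subspace.add_mem[OF C_seminormed]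
    seminormed_subspace.scale_mem[OF C_seminormed]
  show "subspace W" unfolding subspace_def W_def by (simp add: C)
  show "NW (x + y) \<le> NW x + NW y" if "x \<in> W" "y \<in> W" for x y
    unfolding NW_def sum.distrib[symmetric] using that
    by (intro sum_mono) (simp add: W_def seminormed_subspace.N_add[OF C_seminormed])
  show "NW (a *\<^sub>R x) = \<bar>a\<bar> * NW x" if "x \<in> W" for a x
    unfolding NW_def sum_distrib_left using that
    by (intro sum.cong) (simp_all add: W_def seminormed_subspace.N_scale[OF C_seminormed])
qed

lemma NC_le_NW: "x \<in> W \<Longrightarrow> t \<le> T \<Longrightarrow> NC t (x t) \<le> NW x"
  unfolding NW_def W_def
  by (rule member_le_sum) (auto intro: seminormed_subspace.N_nonneg[OF C_seminormed])

lemma complete_W: "complete_seminormed_subspace W NW"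
proof -
  interpret W: seminormed_subspace W NW by (rule seminormed_W)
  show ?thesis
  proof
    fix x :: "nat \<Rightarrow> nat \<Rightarrow> 'a \<Rightarrow> real^'d"
    assume x: "\<And>n. x n \<in> W" and cauchy: "\<And>e. 0 < e \<Longrightarrow> \<exists>k. \<forall>m\<ge>k. \<forall>n\<ge>k. NW (x m - x n) < e"
    have "\<exists>l\<in>C t. (\<lambda>n. NC t (x n t - l)) \<longlonglongrightarrow> 0" if t: "t \<le> T" for t
    proof (rule complete_seminormed_subspace.complete[OF C_complete[OF t]])
      show "x n t \<in> C t" for n using x[of n] t by (simp add: W_def)
      fix e :: real assume "0 < e"
      then obtain k where k: "\<forall>m\<ge>k. \<forall>n\<ge>k. NW (x m - x n) < e" using cauchy by blast
      have "NC t (x m t - x n t) < e" if "k \<le> m" "k \<le> n" for m n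
      proof -
        have "NC t ((x m - x n) t) \<le> NW (x m - x n)" by (rule NC_le_NW[OF W.diff_mem[OF x x] t])
        also have "\<dots> < e" using k that by blast
        finally show ?thesis by (simp only: fun_diff_def)
      qed
      then show "\<exists>k. \<forall>m\<ge>k. \<forall>n\<ge>k. NC t (x m t - x n t) < e" by blast
    qed
    then obtain l where l: "\<And>t. t \<le> T \<Longrightarrow> l t \<in> C t" "\<And>t. t \<le> T \<Longrightarrow> (\<lambda>n. NC t (x n t - l t)) \<longlonglongrightarrow> 0"
      by metis
    have "(\<lambda>n. NW (x n - l)) \<longlonglongrightarrow> (\<Sum>t\<le>T. 0)"
      unfolding NW_def by (intro tendsto_sum) (simp add: l(2))
    then show "\<exists>l\<in>W. (\<lambda>n. NW (x n - l)) \<longlonglongrightarrow> 0"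
      using l(1) by (intro bexI[of _ l]) (auto simp: W_def)
  qed
qed

sublocale W: complete_seminormed_subspace W NW by (rule complete_W)

lemma A_eq_sum: "A x = (\<Sum>t\<le>T. comp_proj T X t (x t))"
proof
  fix s
  have "(\<Sum>t\<in>I. comp_proj T X t (x t)) s = (\<Sum>t\<in>I. comp_proj T X t (x t) s)" if "finite I" for I
    using that by (induction I rule: finite_induct) auto
  then show "A x s = (\<Sum>t\<le>T. comp_proj T X t (x t)) s" by (simp add: A_def)
qed

lemma A_add: "A (x + y) = A x + A y"
  by (simp add: A_eq_sum comp_proj_add sum.distrib)

lemma A_scale: "A (a *\<^sub>R x) = a *\<^sub>R A x"
  by (simp add: A_eq_sum comp_proj_scale scaleR_sum_right)

lemma A_diff: "A (x - y) = A x - A y"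
  by (simp add: A_eq_sum comp_proj_diff sum_subtractf)

lemma comp_proj_mem: "t \<le> T \<Longrightarrow> y \<in> C t \<Longrightarrow> comp_proj T X t y \<in> V"
  by (rule comp_proj_bounded(1)[OF weights])

lemma A_mem: "x \<in> W \<Longrightarrow> A x \<in> V"
  unfolding A_eq_sum W_def by (intro subspace_sum[OF V.subspace] comp_proj_mem) auto

lemma NV_A_le: assumes "x \<in> W" shows "NV (A x) \<le> NW x"
proof -
  have "NV (A x) \<le> (\<Sum>t\<le>T. NV (comp_proj T X t (x t)))"
    unfolding A_eq_sum using assms by (intro V.N_sum_le comp_proj_mem) (auto simp: W_def)
  also have "\<dots> \<le> NW x"
    unfolding NW_def using assms by (intro sum_mono comp_proj_bounded(2)[OF weights]) (auto simp: W_def)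
  finally show ?thesis .
qed

lemma linear_A:
  assumes l: "linear_on V l" and x: "x \<in> W"
  shows "l (A x) = (\<Sum>t\<le>T. marginal T X t l (x t))"
  unfolding A_eq_sum marginal_def
  by (rule linear_on_sum[OF V.subspace l]) (use x comp_proj_mem in \<open>auto simp: W_def\<close>)

lemma G_not_MInf: "t \<le> T \<Longrightarrow> y \<in> C t \<Longrightarrow> G t y \<noteq> -\<infinity>"
  using G_proper[of t] by (auto simp: proper_fun_def)

lemma H_not_MInf: "z \<in> V \<Longrightarrow> H z \<noteq> -\<infinity>"
  using H_proper by (auto simp: proper_fun_def)

lemma F_not_MInf: assumes "x \<in> W" "u \<in> V" shows "F x u \<noteq> -\<infinity>"
proof -
  have "(\<Sum>t\<le>T. G t (x t)) \<noteq> -\<infinity>"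
    using assms by (intro sum_not_MInf G_not_MInf) (auto simp: W_def)
  moreover have "H (u - A x) \<noteq> -\<infinity>" using assms by (intro H_not_MInf V.diff_mem A_mem)
  ultimately show ?thesis by (simp add: F_def)
qed

lemma F_real:
  assumes x: "x \<in> W" "u \<in> V" and fin: "F x u < \<infinity>"
  obtains g h where "\<And>t. t \<le> T \<Longrightarrow> G t (x t) = ereal (g t)" "H (u - A x) = ereal h"
    "F x u = ereal ((\<Sum>t\<le>T. g t) + h)"
proof -
  have Gs: "(\<Sum>t\<le>T. G t (x t)) \<noteq> -\<infinity>"
    using x by (intro sum_not_MInf G_not_MInf) (auto simp: W_def)
  have Hs: "H (u - A x) \<noteq> -\<infinity>" using x by (intro H_not_MInf V.diff_mem A_mem)
  have "(\<Sum>t\<le>T. G t (x t)) \<noteq> \<infinity>" and Hf: "H (u - A x) \<noteq> \<infinity>"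
    using fin Gs Hs by (auto simp: F_def)
  then have "G t (x t) \<noteq> \<infinity>" if "t \<le> T" for t using that by (auto simp: sum_Pinfty)
  then have "\<exists>r. G t (x t) = ereal r" if "t \<le> T" for t
    using G_not_MInf[OF that, of "x t"] x(1) that by (cases "G t (x t)") (auto simp: W_def)
  then obtain g where g: "\<And>t. t \<le> T \<Longrightarrow> G t (x t) = ereal (g t)" by metis
  obtain h where h: "H (u - A x) = ereal h" using Hs Hf by (cases "H (u - A x)") auto
  have "(\<Sum>t\<le>T. G t (x t)) = ereal (\<Sum>t\<le>T. g t)" using g by simp
  then have "F x u = ereal ((\<Sum>t\<le>T. g t) + h)" using h by (simp add: F_def)
  with g h show thesis using that by blast
qed

lemma value_fun_eq: "value_fun T X \<psi> G H u = \<phi> u"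
proof -
  have F: "(\<Sum>t\<le>T. G t (x t)) + H (\<lambda>s. u s - (\<Sum>t\<le>T. comp_proj T X t (x t) s)) = F x u" for x
    by (simp add: F_def A_def fun_diff_def)
  have sub: "prod_space T X \<psi> \<subseteq> W" by (auto simp: prod_space_def W_def)
  have restr: "restrict x {..T} \<in> prod_space T X \<psi> \<and> F (restrict x {..T}) u = F x u" if "x \<in> W" for x
    using that by (auto simp: prod_space_def W_def F_def A_def)
  show ?thesis
    unfolding value_fun_def \<phi>_def F
  proof (rule antisym)
    show "(INF x\<in>W. F x u) \<le> (INF x\<in>prod_space T X \<psi>. F x u)"
      by (rule INF_superset_mono[OF sub]) simp
    show "(INF x\<in>prod_space T X \<psi>. F x u) \<le> (INF x\<in>W. F x u)"
      using restr by (intro INF_greatest) (metis INF_lower)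
  qed
qed

lemma prod_space_sub: "x \<in> prod_space T X \<psi> \<Longrightarrow> x \<in> W"
  by (auto simp: prod_space_def W_def)

lemma primal_obj_eq: "primal_obj T X G H x = F x 0"
  by (simp add: primal_obj_def F_def A_def fun_diff_def)

lemma primal_inf_eq: "primal_inf T X \<psi> G H = \<phi> 0"
  unfolding value_fun_eq[symmetric] by (simp add: primal_inf_def primal_obj_def value_fun_def)

lemma weak_duality:
  assumes l: "l \<in> weighted_dual (path_top T X) (path_weight T \<psi>)"
  shows "- \<phi> 0 \<le> dual_obj T X \<psi> G H l"
proof -
  have lin: "linear_on V l" using l by (simp add: weighted_dual_iff)
  have "- F x 0 \<le> dual_obj T X \<psi> G H l" if x: "x \<in> W" for x
  proof (cases "F x 0 < \<infinity>")
    case True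
    from F_real[OF x V.zero_mem this] obtain g h where g: "\<And>t. t \<le> T \<Longrightarrow> G t (x t) = ereal (g t)"
      and h: "H (0 - A x) = ereal h" and F: "F x 0 = ereal ((\<Sum>t\<le>T. g t) + h)" by blast
    have "ereal (\<Sum>t\<le>T. marginal T X t l (x t) - g t)
        = (\<Sum>t\<le>T. ereal (marginal T X t l (x t) - g t))" by simp
    also have "\<dots> \<le> (\<Sum>t\<le>T. conjugate (X t) (\<psi> t) (G t) (marginal T X t l))"
      unfolding conjugate_def using x g
      by (intro sum_mono SUP_upper2[where i="x _"]) (auto simp: W_def)
    finally have 1: "ereal (\<Sum>t\<le>T. marginal T X t l (x t) - g t) \<le> \<dots>" .
    have "ereal (l (0 - A x) - h) \<le> conjugate (path_top T X) (path_weight T \<psi>) H l"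
      unfolding conjugate_def using h by (intro SUP_upper2[OF V.diff_mem[OF V.zero_mem A_mem[OF x]]]) simp
    then have "ereal (\<Sum>t\<le>T. marginal T X t l (x t) - g t) + ereal (l (0 - A x) - h) \<le> dual_obj T X \<psi> G H l"
      unfolding dual_obj_def using 1 by (intro add_mono)
    moreover have "(\<Sum>t\<le>T. marginal T X t l (x t) - g t) + (l (0 - A x) - h) = - ((\<Sum>t\<le>T. g t) + h)"
      using linear_A[OF lin x] linear_on_neg[OF lin A_mem[OF x]] by (simp add: sum_subtractf)
    ultimately show ?thesis by (simp only: F plus_ereal.simps uminus_ereal.simps)
  qed simp
  then have "- dual_obj T X \<psi> G H l \<le> \<phi> 0"
    unfolding \<phi>_def by (intro INF_greatest) (simp add: ereal_uminus_le_reorder)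
  then show ?thesis by (simp add: ereal_uminus_le_reorder)
qed

text \<open>
  A subgradient of the value function at 0 is dual optimal: with \<open>u = z + A x\<close> the inequality
  \<open>c + l u \<le> F x u\<close> separates into terms that depend on one \<open>x t\<close> or on \<open>z\<close> alone, and the suprema over
  these independent variables are the conjugates.
\<close>

lemma dual_obj_le_of_subgradient:
  assumes l: "linear_on V l"
    and sub: "\<And>u. u \<in> V \<Longrightarrow> ereal (c + l u) \<le> \<phi> u"
  shows "dual_obj T X \<psi> G H l \<le> ereal (- c)"
proof -
  have key: "(\<Sum>t\<le>T. a t) + b \<le> - c"
    if a: "\<And>t. t \<in> {..T} \<Longrightarrow> ereal (a t) < conjugate (X t) (\<psi> t) (G t) (marginal T X t l)"
      and b: "ereal b < conjugate (path_top T X) (path_weight T \<psi>) H l" for a b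
  proof -
    have "\<exists>y g. y \<in> C t \<and> G t y = ereal g \<and> a t < marginal T X t l y - g" if t: "t \<le> T" for t
    proof -
      obtain y where y: "y \<in> C t" "ereal (a t) < ereal (marginal T X t l y) - G t y"
        using a[of t] t unfolding conjugate_def less_SUP_iff by auto
      then show ?thesis using G_not_MInf[OF t y(1)] by (metis less_ereal_minusD)
    qed
    then obtain x g where x: "\<And>t. t \<le> T \<Longrightarrow> x t \<in> C t" and g: "\<And>t. t \<le> T \<Longrightarrow> G t (x t) = ereal (g t)"
      and ag: "\<And>t. t \<le> T \<Longrightarrow> a t < marginal T X t l (x t) - g t"
      by metis
    have xW: "x \<in> W" using x by (simp add: W_def)
    obtain z where z: "z \<in> V" "ereal b < ereal (l z) - H z"
      using b unfolding conjugate_def less_SUP_iff by blast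
    then obtain h where h: "H z = ereal h" "b < l z - h" using H_not_MInf[OF z(1)] by (metis less_ereal_minusD)
    have "ereal (c + l (z + A x)) \<le> \<phi> (z + A x)" by (intro sub V.add_mem A_mem z xW)
    also have "\<dots> \<le> F x (z + A x)" unfolding \<phi>_def by (rule INF_lower[OF xW])
    also have "\<dots> = ereal ((\<Sum>t\<le>T. g t) + h)"
      using g h by (simp add: F_def)
    finally have "c + l z + (\<Sum>t\<le>T. marginal T X t l (x t)) \<le> (\<Sum>t\<le>T. g t) + h"
      using linear_on_add[OF l z(1) A_mem[OF xW]] linear_A[OF l xW] by simp
    moreover have "(\<Sum>t\<le>T. a t) \<le> (\<Sum>t\<le>T. marginal T X t l (x t) - g t)"
      using ag by (intro sum_mono) (auto intro: less_imp_le)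
    ultimately show ?thesis using h(2) by (simp add: sum_subtractf)
  qed
  have "conjugate (path_top T X) (path_weight T \<psi>) H l
      + (\<Sum>t\<le>T. conjugate (X t) (\<psi> t) (G t) (marginal T X t l)) \<le> ereal (- c)"
  proof (rule add_le_of_real_below)
    show "conjugate (path_top T X) (path_weight T \<psi>) H l \<noteq> -\<infinity>"
      by (rule conjugate_not_MInf[OF H_proper])
    show "(\<Sum>t\<le>T. conjugate (X t) (\<psi> t) (G t) (marginal T X t l)) \<noteq> -\<infinity>"
      by (intro sum_not_MInf conjugate_not_MInf G_proper) simp
    fix b assume b: "ereal b < conjugate (path_top T X) (path_weight T \<psi>) H l"
    have "(\<Sum>t\<le>T. conjugate (X t) (\<psi> t) (G t) (marginal T X t l)) \<le> ereal (- c - b)"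
    proof (rule sum_le_of_real_below)
      show "conjugate (X t) (\<psi> t) (G t) (marginal T X t l) \<noteq> -\<infinity>" if "t \<in> {..T}" for t
        using that by (intro conjugate_not_MInf G_proper) simp
      fix a assume "\<And>t. t \<in> {..T} \<Longrightarrow> ereal (a t) < conjugate (X t) (\<psi> t) (G t) (marginal T X t l)"
      from key[OF this b] show "ereal (\<Sum>t\<le>T. a t) \<le> ereal (- c - b)" by simp
    qed simp
    then have "ereal b + (\<Sum>t\<le>T. conjugate (X t) (\<psi> t) (G t) (marginal T X t l)) \<le> ereal b + ereal (- c - b)"
      by (rule add_left_mono)
    then show "ereal b + (\<Sum>t\<le>T. conjugate (X t) (\<psi> t) (G t) (marginal T X t l)) \<le> ereal (- c)" by simp
  qed
  then show ?thesis by (simp add: dual_obj_def add.commute)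
qed

text \<open>
  At a primal solution, the inequality defining a subgradient of the value function becomes the
  optimality conditions when all but one of the variables \<open>x t\<close> and \<open>z\<close> are kept fixed.
\<close>

lemma subgradient_imp_optimality_conditions:
  assumes l: "l \<in> weighted_dual (path_top T X) (path_weight T \<psi>)"
    and sub: "\<And>u. u \<in> V \<Longrightarrow> ereal (c + l u) \<le> \<phi> u"
    and x: "x \<in> W" and Fx: "F x 0 = ereal c"
  shows "optimality_conditions T X \<psi> G H x l"
proof -
  have lin: "linear_on V l" using l by (simp add: weighted_dual_iff)
  from F_real[OF x V.zero_mem] Fx obtain g h where g: "\<And>t. t \<le> T \<Longrightarrow> G t (x t) = ereal (g t)"
    and h: "H (0 - A x) = ereal h" and c: "c = (\<Sum>t\<le>T. g t) + h" by auto
  have ineq: "ereal (c + l (z + A y)) \<le> (\<Sum>t\<le>T. G t (y t)) + H z" if "y \<in> W" "z \<in> V" for y z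
  proof -
    have "ereal (c + l (z + A y)) \<le> \<phi> (z + A y)" by (intro sub V.add_mem A_mem that)
    also have "\<dots> \<le> F y (z + A y)" unfolding \<phi>_def by (rule INF_lower[OF that(1)])
    finally show ?thesis by (simp add: F_def)
  qed
  have zV: "0 - A x \<in> V" by (intro V.diff_mem V.zero_mem A_mem x)
  have "marginal T X t l \<in> subdifferential (X t) (\<psi> t) (G t) (x t)" if t: "t \<le> T" for t
    unfolding subdifferential_def
  proof (intro CollectI conjI ballI marginal_in_weighted_dual[OF weights t l])
    fix y assume y: "y \<in> C t"
    interpret Ct: seminormed_subspace "C t" "NC t" by (rule C_seminormed[OF t])
    have xt: "x t \<in> C t" using x t by (simp add: W_def)
    have lint: "linear_on (C t) (marginal T X t l)"
      using marginal_in_weighted_dual[OF weights t l] by (simp add: weighted_dual_iff)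
    have diff: "marginal T X t l (\<lambda>s. y s - x t s) = marginal T X t l y - marginal T X t l (x t)"
      using linear_on_diff[OF Ct.subspace lint y xt] by (simp add: fun_diff_def)
    show "G t (x t) + ereal (marginal T X t l (\<lambda>s. y s - x t s)) \<le> G t y"
    proof (cases "G t y")
      case (real r)
      let ?x = "x(t := y)"
      have xW: "?x \<in> W" using x y by (auto simp: W_def)
      have "(\<Sum>s\<le>T. G s (?x s)) = (\<Sum>s\<le>T. ereal ((g(t := r)) s))"
        using g real by (intro sum.cong) auto
      also have "\<dots> = ereal ((\<Sum>s\<le>T. g s) - g t + r)"
        using sum_fun_upd[OF t, of "\<lambda>s v. v" g r] by simp
      finally have "c + l ((0 - A x) + A ?x) \<le> (\<Sum>s\<le>T. g s) - g t + r + h"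
        using ineq[OF xW zV] h by simp
      moreover have "l ((0 - A x) + A ?x) = marginal T X t l y - marginal T X t l (x t)"
        using linear_on_add[OF lin zV A_mem[OF xW]] linear_on_neg[OF lin A_mem[OF x]]
          linear_A[OF lin xW] linear_A[OF lin x] sum_fun_upd[OF t, of "\<lambda>s. marginal T X s l" x y] by simp
      ultimately show ?thesis using g[OF t] real c diff by simp
    qed (use G_not_MInf[OF t y] in auto)
  qed
  moreover have "l \<in> subdifferential (path_top T X) (path_weight T \<psi>) H (0 - A x)"
    unfolding subdifferential_def
  proof (intro CollectI conjI ballI l)
    fix z assume z: "z \<in> V"
    have "(\<lambda>s. z s - (0 - A x) s) = z + A x" by (simp add: fun_eq_iff)
    then have diff: "l (\<lambda>s. z s - (0 - A x) s) = l z + l (A x)"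
      using linear_on_add[OF lin z A_mem[OF x]] by simp
    show "H (0 - A x) + ereal (l (\<lambda>s. z s - (0 - A x) s)) \<le> H z"
    proof (cases "H z")
      case (real r)
      have "(\<Sum>s\<le>T. G s (x s)) = ereal (\<Sum>s\<le>T. g s)" using g by simp
      then have "c + l (z + A x) \<le> (\<Sum>s\<le>T. g s) + r"
        using ineq[OF x z] real by simp
      then show ?thesis using h real c diff linear_on_add[OF lin z A_mem[OF x]] by simp
    qed (use H_not_MInf[OF z] in auto)
  qed
  moreover have "(\<lambda>s. - (\<Sum>t\<le>T. comp_proj T X t (x t) s)) = 0 - A x"
    by (simp add: A_def fun_eq_iff)
  ultimately show ?thesis unfolding optimality_conditions_def by simp
qed

lemma optimality_conditions_imp_optimal:
  assumes l: "l \<in> weighted_dual (path_top T X) (path_weight T \<psi>)" and x: "x \<in> W"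
    and opt: "optimality_conditions T X \<psi> G H x l"
  shows "F x 0 = \<phi> 0" and "dual_obj T X \<psi> G H l = - \<phi> 0"
proof -
  have lin: "linear_on V l" using l by (simp add: weighted_dual_iff)
  have "(\<lambda>s. - (\<Sum>t\<le>T. comp_proj T X t (x t) s)) = 0 - A x"
    by (simp add: A_def fun_eq_iff)
  then have lG: "\<And>t. t \<le> T \<Longrightarrow> marginal T X t l \<in> subdifferential (X t) (\<psi> t) (G t) (x t)"
    and lH: "l \<in> subdifferential (path_top T X) (path_weight T \<psi>) H (0 - A x)"
    using opt by (simp_all add: optimality_conditions_def)
  have "\<exists>r. G t (x t) = ereal r \<and> conjugate (X t) (\<psi> t) (G t) (marginal T X t l)
      \<le> ereal (marginal T X t l (x t) - r)" if t: "t \<le> T" for t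
    using subgradient_conjugate[OF weightC[OF t] G_proper[OF t] lG[OF t]] x t by (auto simp: W_def)
  then obtain g where g: "\<And>t. t \<le> T \<Longrightarrow> G t (x t) = ereal (g t)"
    and Gc: "\<And>t. t \<le> T \<Longrightarrow> conjugate (X t) (\<psi> t) (G t) (marginal T X t l)
      \<le> ereal (marginal T X t l (x t) - g t)" by metis
  obtain h where h: "H (0 - A x) = ereal h"
    and Hc: "conjugate (path_top T X) (path_weight T \<psi>) H l \<le> ereal (l (0 - A x) - h)"
    using subgradient_conjugate[OF weightV H_proper lH V.diff_mem[OF V.zero_mem A_mem[OF x]]] .
  have "dual_obj T X \<psi> G H l \<le> (\<Sum>t\<le>T. ereal (marginal T X t l (x t) - g t)) + ereal (l (0 - A x) - h)"
    unfolding dual_obj_def by (intro add_mono sum_mono Gc Hc) auto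
  also have "\<dots> = - ereal ((\<Sum>t\<le>T. g t) + h)"
    using linear_A[OF lin x] linear_on_neg[OF lin A_mem[OF x]] by (simp add: sum_subtractf)
  also have "ereal ((\<Sum>t\<le>T. g t) + h) = F x 0" using g h by (simp add: F_def)
  finally have 1: "dual_obj T X \<psi> G H l \<le> - F x 0" .
  have 2: "\<phi> 0 \<le> F x 0" unfolding \<phi>_def by (rule INF_lower[OF x])
  have 3: "- \<phi> 0 \<le> dual_obj T X \<psi> G H l" by (rule weak_duality[OF l])
  from 1 3 have "- \<phi> 0 \<le> - F x 0" by (rule order_trans[rotated])
  then have "F x 0 \<le> \<phi> 0" by simp
  with 2 show eq: "F x 0 = \<phi> 0" by simp
  show "dual_obj T X \<psi> G H l = - \<phi> 0" using 1 3 eq by simp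
qed

end

section \<open>Dual attainment under the constraint qualification\<close>

lemma convex_funD:
  fixes f :: "('p \<Rightarrow> real^'d) \<Rightarrow> ereal" and x y z :: "'p \<Rightarrow> real^'d"
  assumes f: "convex_fun Y w f" and x: "x \<in> weighted_space Y w" "f x \<le> ereal a"
    and y: "y \<in> weighted_space Y w" "f y \<le> ereal b" and s: "0 < s" "s < 1"
    and z: "z = s *\<^sub>R x + (1 - s) *\<^sub>R y"
  shows "f z \<le> ereal (s * a + (1 - s) * b)"
proof -
  have z': "z = (\<lambda>p. s *\<^sub>R x p + (1 - s) *\<^sub>R y p)" using z by (simp add: fun_eq_iff)
  have "f z \<le> ereal s * f x + ereal (1 - s) * f y"
    unfolding z' using f x(1) y(1) s unfolding convex_fun_def by blast
  also have "\<dots> \<le> ereal s * ereal a + ereal (1 - s) * ereal b"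
    using x y s by (intro add_mono ereal_mult_left_mono) auto
  finally show ?thesis by simp
qed

locale stable_primal_dual_setting = primal_dual_setting T X \<psi> G H
  for T :: nat and X :: "nat \<Rightarrow> 'a topology" and \<psi> :: "nat \<Rightarrow> 'a \<Rightarrow> real"
    and G :: "nat \<Rightarrow> ('a \<Rightarrow> real^'d) \<Rightarrow> ereal"
    and H :: "((nat \<Rightarrow> 'a) \<Rightarrow> real^'d) \<Rightarrow> ereal" +
  assumes G_convex: "\<And>t. t \<le> T \<Longrightarrow> convex_fun (X t) (\<psi> t) (G t)"
    and G_lsc: "\<And>t. t \<le> T \<Longrightarrow> lsc_fun (X t) (\<psi> t) (G t)"
    and H_convex: "convex_fun (path_top T X) (path_weight T \<psi>) H"
    and H_lsc: "lsc_fun (path_top T X) (path_weight T \<psi>) H"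
    and cq: "closed_linear_subspace (path_top T X) (path_weight T \<psi>)
      (\<Union>\<alpha>\<in>{0::real<..}. (\<lambda>u s. \<alpha> *\<^sub>R u s) ` dom_value_fun T X \<psi> G H)"
begin

text \<open>The cone generated by the domain of the value function, a closed subspace by assumption.\<close>

definition K :: "((nat \<Rightarrow> 'a) \<Rightarrow> real^'d) set" where
  "K = {\<alpha> *\<^sub>R u | \<alpha> u. 0 < \<alpha> \<and> u \<in> V \<and> \<phi> u < \<infinity>}"

lemma K_closed_subspace: "closed_linear_subspace (path_top T X) (path_weight T \<psi>) K"
proof -
  have "(\<Union>\<alpha>\<in>{0::real<..}. (\<lambda>u s. \<alpha> *\<^sub>R u s) ` dom_value_fun T X \<psi> G H) = K"
    unfolding K_def dom_value_fun_def value_fun_eq scaleR_fun_def by auto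
  then show ?thesis using cq by simp
qed

lemma K_subset: "K \<subseteq> V" by (auto simp: K_def V.scale_mem)

lemma dom_subset_K: "u \<in> V \<Longrightarrow> \<phi> u < \<infinity> \<Longrightarrow> u \<in> K"
  unfolding K_def by (intro CollectI exI[of _ 1] exI[of _ u]) simp

lemma subspace_K: "subspace K"
proof -
  have ne: "K \<noteq> {}" and add: "\<And>x y. x \<in> K \<Longrightarrow> y \<in> K \<Longrightarrow> x + y \<in> K"
    and scale: "\<And>x a. x \<in> K \<Longrightarrow> a *\<^sub>R x \<in> K"
    using K_closed_subspace by (auto simp: closed_linear_subspace_def fun_ops)
  from ne obtain x where "x \<in> K" by blast
  from scale[OF this, of 0] have "0 \<in> K" by simp
  with add scale show ?thesis unfolding subspace_def by blast
qed

lemma value_zero_less: "\<phi> 0 < \<infinity>"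
  using subspace_0[OF subspace_K] by (auto simp: K_def)

lemma complete_K: "complete_seminormed_subspace K NV"
proof -
  have KV: "x \<in> V" if "x \<in> K" for x using that K_subset by blast
  show ?thesis
  proof
    show "subspace K" by (rule subspace_K)
    show "NV (x + y) \<le> NV x + NV y" if "x \<in> K" "y \<in> K" for x y
      using that KV by (intro V.N_add)
    show "NV (a *\<^sub>R x) = \<bar>a\<bar> * NV x" if "x \<in> K" for a x
      using that KV by (intro V.N_scale)
    fix x :: "nat \<Rightarrow> (nat \<Rightarrow> 'a) \<Rightarrow> real^'d"
    assume x: "\<And>n. x n \<in> K" and cauchy: "\<And>e. 0 < e \<Longrightarrow> \<exists>k. \<forall>m\<ge>k. \<forall>n\<ge>k. NV (x m - x n) < e"
    obtain l where l: "l \<in> V" "(\<lambda>n. NV (x n - l)) \<longlonglongrightarrow> 0"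
      using V.complete[of x] KV[OF x] cauchy by blast
    have "closedin (weighted_topology (path_top T X) (path_weight T \<psi>)) K"
      using K_closed_subspace by (simp add: closed_linear_subspace_def)
    then have "l \<in> K" by (rule closedin_weighted_sequentially[OF weightV _ x l])
    with l(2) show "\<exists>l\<in>K. (\<lambda>n. NV (x n - l)) \<longlonglongrightarrow> 0" by blast
  qed
qed

text \<open>
  The sets to which the open mapping theorem is applied. Bounding each function by \<open>k\<close>, instead of
  the sum \<open>F\<close>, makes the sets closed by lower semicontinuity of the individual functions.
\<close>

definition D :: "nat \<Rightarrow> ((nat \<Rightarrow> 'a \<Rightarrow> real^'d) \<times> ((nat \<Rightarrow> 'a) \<Rightarrow> real^'d)) set" where
  "D k = {(x, u). x \<in> W \<and> u \<in> V \<and> NW x \<le> real k \<and> (\<forall>t\<le>T. G t (x t) \<le> ereal (real k))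
            \<and> H (u - A x) \<le> ereal (real k)}"

lemma F_le_on_D:
  assumes "(x, u) \<in> D k"
  shows "F x u \<le> ereal (real (Suc T) * real k + real k)"
proof -
  have "F x u \<le> (\<Sum>t\<le>T. ereal (real k)) + ereal (real k)"
    unfolding F_def using assms by (intro add_mono sum_mono) (auto simp: D_def)
  then show ?thesis by simp
qed

lemma value_le_on_D:
  assumes "(x, u) \<in> D k"
  shows "\<phi> u \<le> ereal (real (Suc T) * real k + real k)"
proof -
  have "x \<in> W" using assms by (simp add: D_def)
  then have "\<phi> u \<le> F x u" unfolding \<phi>_def by (rule INF_lower)
  then show ?thesis using F_le_on_D[OF assms] by (rule order_trans)
qed

lemma value_finite_obtain_D:
  assumes u: "u \<in> V" and fin: "\<phi> u < \<infinity>"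
  obtains k x where "(x, u) \<in> D k"
proof -
  obtain x where x: "x \<in> W" "F x u < \<infinity>" using fin unfolding \<phi>_def INF_less_iff by blast
  obtain g h where g: "\<And>t. t \<le> T \<Longrightarrow> G t (x t) = ereal (g t)" and h: "H (u - A x) = ereal h"
    using F_real[OF x(1) u x(2)] by blast
  define k where "k = nat \<lceil>NW x + (\<Sum>t\<le>T. \<bar>g t\<bar>) + \<bar>h\<bar>\<rceil>"
  have k: "NW x + (\<Sum>t\<le>T. \<bar>g t\<bar>) + \<bar>h\<bar> \<le> real k" unfolding k_def by linarith
  have gs: "\<bar>g t\<bar> \<le> (\<Sum>t\<le>T. \<bar>g t\<bar>)" if "t \<le> T" for t
    using that by (intro member_le_sum) auto
  have g0: "0 \<le> (\<Sum>t\<le>T. \<bar>g t\<bar>)" by (intro sum_nonneg) simp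
  have "g t \<le> real k" if "t \<le> T" for t
    using gs[OF that] k W.N_nonneg[OF x(1)] by linarith
  moreover have "NW x \<le> real k" "h \<le> real k" using k g0 W.N_nonneg[OF x(1)] by linarith+
  ultimately have "(x, u) \<in> D k" using x u g h by (simp add: D_def)
  then show thesis by (rule that)
qed

lemma convex_D: "convex (D k)"
proof (rule convexI)
  fix p q :: "(nat \<Rightarrow> 'a \<Rightarrow> real^'d) \<times> ((nat \<Rightarrow> 'a) \<Rightarrow> real^'d)" and s r :: real
  assume p: "p \<in> D k" and q: "q \<in> D k" and s: "0 \<le> s" and r: "0 \<le> r" and sr: "s + r = 1"
  obtain x u y v where pq: "p = (x, u)" "q = (y, v)" by fastforce
  have x: "x \<in> W" "u \<in> V" "NW x \<le> k" "\<And>t. t \<le> T \<Longrightarrow> G t (x t) \<le> ereal k" "H (u - A x) \<le> ereal k"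
    using p by (auto simp: pq D_def)
  have y: "y \<in> W" "v \<in> V" "NW y \<le> k" "\<And>t. t \<le> T \<Longrightarrow> G t (y t) \<le> ereal k" "H (v - A y) \<le> ereal k"
    using q by (auto simp: pq D_def)
  show "s *\<^sub>R p + r *\<^sub>R q \<in> D k"
  proof (cases "s = 0 \<or> s = 1")
    case True
    then show ?thesis using p q sr by auto
  next
    case False
    then have s': "0 < s" "s < 1" and r': "r = 1 - s" using s r sr by auto
    have k: "s * real k + (1 - s) * real k = real k" by (simp add: algebra_simps)
    let ?x = "s *\<^sub>R x + (1 - s) *\<^sub>R y" and ?u = "s *\<^sub>R u + (1 - s) *\<^sub>R v"
    have "NW ?x \<le> s * NW x + (1 - s) * NW y"
      using W.N_add[OF W.scale_mem[OF x(1), of s] W.scale_mem[OF y(1), of "1 - s"]] s'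
        W.N_scale[OF x(1), of s] W.N_scale[OF y(1), of "1 - s"] by simp
    also have "\<dots> \<le> s * real k + (1 - s) * real k"
      using x(3) y(3) s' by (intro add_mono mult_left_mono) auto
    finally have N: "NW ?x \<le> real k" using k by simp
    have Gk: "G t (?x t) \<le> ereal (real k)" if t: "t \<le> T" for t
    proof -
      have "x t \<in> C t" "y t \<in> C t" using x(1) y(1) t by (simp_all add: W_def)
      then have "G t (?x t) \<le> ereal (s * real k + (1 - s) * real k)"
        by (rule convex_funD[OF G_convex[OF t] _ x(4)[OF t] _ y(4)[OF t] s']) (simp add: fun_eq_iff)
      then show ?thesis unfolding k .
    qed
    have "?u - A ?x = s *\<^sub>R (u - A x) + (1 - s) *\<^sub>R (v - A y)"
      unfolding A_add A_scale by (simp add: scaleR_diff_right)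
    then have "H (?u - A ?x) \<le> ereal (s * real k + (1 - s) * real k)"
      using V.diff_mem[OF x(2) A_mem[OF x(1)]] V.diff_mem[OF y(2) A_mem[OF y(1)]] x(5) y(5) s'
      by (intro convex_funD[where f = H and x = "u - A x" and y = "v - A y", OF H_convex])
    then have "H (?u - A ?x) \<le> ereal (real k)" unfolding k .
    moreover have "?x \<in> W" "?u \<in> V"
      by (intro W.add_mem W.scale_mem V.add_mem V.scale_mem x y)+
    ultimately have "(?x, ?u) \<in> D k" using N Gk unfolding D_def by blast
    then show ?thesis by (simp add: pq r')
  qed
qed

lemma closed_D:
  assumes D: "\<And>n. (x n, u n) \<in> D k" and x': "x' \<in> W" and u': "u' \<in> V"
    and lx: "(\<lambda>n. NW (x n - x')) \<longlonglongrightarrow> 0" and lu: "(\<lambda>n. NV (u n - u')) \<longlonglongrightarrow> 0"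
  shows "(x', u') \<in> D k"
proof -
  have x: "x n \<in> W" and u: "u n \<in> V" and Nx: "NW (x n) \<le> k"
    and Gx: "\<And>t. t \<le> T \<Longrightarrow> G t (x n t) \<le> ereal k" and Hx: "H (u n - A (x n)) \<le> ereal k" for n
    using D[of n] by (auto simp: D_def)
  have "NW x' \<le> real k + 0"
  proof (rule LIMSEQ_le_const)
    show "(\<lambda>n. real k + NW (x n - x')) \<longlonglongrightarrow> real k + 0" by (intro tendsto_add tendsto_const lx)
    have "NW x' \<le> real k + NW (x n - x')" for n
      using W.N_diff_le[OF x[of n] W.diff_mem[OF x[of n] x']] Nx[of n] by simp
    then show "\<exists>N. \<forall>n\<ge>N. NW x' \<le> real k + NW (x n - x')" by blast
  qed
  moreover have "G t (x' t) \<le> ereal k" if t: "t \<le> T" for t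
  proof -
    let ?L = "{y \<in> C t. G t y \<le> ereal k}"
    have "x' t \<in> ?L"
    proof (rule closedin_weighted_sequentially[OF weightC[OF t]])
      show "closedin (weighted_topology (X t) (\<psi> t)) ?L" using G_lsc[OF t] by (simp add: lsc_fun_def)
      show "x n t \<in> ?L" for n using x[of n] Gx[OF t, of n] t by (simp add: W_def)
      show "x' t \<in> C t" using x' t by (simp add: W_def)
      show "(\<lambda>n. NC t (x n t - x' t)) \<longlonglongrightarrow> 0"
      proof (rule tendsto_sandwich[OF _ _ tendsto_const lx])
        have d: "x n - x' \<in> W" for n by (rule W.diff_mem[OF x x'])
        have "NC t ((x n - x') t) \<le> NW (x n - x')" for n by (rule NC_le_NW[OF d t])
        then show "\<forall>\<^sub>F n in sequentially. NC t (x n t - x' t) \<le> NW (x n - x')" by simp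
        have "0 \<le> NC t ((x n - x') t)" for n
          using d[of n] t by (intro seminormed_subspace.N_nonneg[OF C_seminormed[OF t]]) (simp only: W_def mem_Collect_eq)
        then show "\<forall>\<^sub>F n in sequentially. 0 \<le> NC t (x n t - x' t)" by simp
      qed
    qed
    then show ?thesis by simp
  qed
  moreover have "H (u' - A x') \<le> ereal k"
  proof -
    let ?L = "{z \<in> V. H z \<le> ereal k}"
    have "u' - A x' \<in> ?L"
    proof (rule closedin_weighted_sequentially[OF weightV])
      show "closedin (weighted_topology (path_top T X) (path_weight T \<psi>)) ?L" using H_lsc by (simp add: lsc_fun_def)
      show "u n - A (x n) \<in> ?L" for n using V.diff_mem[OF u A_mem[OF x]] Hx by simp
      show V': "u' - A x' \<in> V" by (rule V.diff_mem[OF u' A_mem[OF x']])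
      show "(\<lambda>n. NV (u n - A (x n) - (u' - A x'))) \<longlonglongrightarrow> 0"
      proof (rule tendsto_sandwich[OF _ _ tendsto_const])
        have eq: "u n - A (x n) - (u' - A x') = (u n - u') - A (x n - x')" for n
          unfolding A_diff by simp
        have "NV (u n - A (x n) - (u' - A x')) \<le> NV (u n - u') + NW (x n - x')" for n
          using V.N_diff_le[OF V.diff_mem[OF u[of n] u'] A_mem[OF W.diff_mem[OF x[of n] x']]]
            NV_A_le[OF W.diff_mem[OF x[of n] x']] unfolding eq by linarith
        then show "\<forall>\<^sub>F n in sequentially. NV (u n - A (x n) - (u' - A x')) \<le> NV (u n - u') + NW (x n - x')"
          by simp
        show "(\<lambda>n. NV (u n - u') + NW (x n - x')) \<longlonglongrightarrow> 0"
          using tendsto_add[OF lu lx] by simp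
        show "\<forall>\<^sub>F n in sequentially. 0 \<le> NV (u n - A (x n) - (u' - A x'))"
          by (intro always_eventually allI V.N_nonneg V.diff_mem V' u A_mem x)
      qed
    qed
    then show ?thesis by simp
  qed
  ultimately show ?thesis using x' u' by (simp add: D_def)
qed

lemma value_bounded_near_zero:
  obtains B r where "0 < r" "\<And>u. u \<in> K \<Longrightarrow> NV u < r \<Longrightarrow> \<phi> u \<le> ereal B"
proof -
  have "\<exists>k r. 0 < r \<and> (\<forall>u. u \<in> K \<longrightarrow> NV u < r \<longrightarrow> (\<exists>x. (x, u) \<in> D k))"
  proof (rule robinson_ursescu[OF complete_K _ complete_W, of D])
    show "u = 0" if "u \<in> K" "NV u = 0" for u
      using weighted_norm_definite[OF weightV] that K_subset by blast
    show "D k \<subseteq> W \<times> K" for k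
    proof (rule subrelI)
      fix x u assume xu: "(x, u) \<in> D k"
      have "\<phi> u < \<infinity>" by (rule le_less_trans[OF value_le_on_D[OF xu]]) simp
      then show "(x, u) \<in> W \<times> K" using xu dom_subset_K by (simp add: D_def)
    qed
    show "D j \<subseteq> D k" if "j \<le> k" for j k
    proof (rule subrelI)
      fix x u assume "(x, u) \<in> D j"
      moreover have "real j \<le> real k" using that by simp
      moreover from this have "ereal (real j) \<le> ereal (real k)" by simp
      ultimately show "(x, u) \<in> D k" unfolding D_def by (auto intro: order_trans)
    qed
    show "convex (D k)" for k by (rule convex_D)
    show "\<exists>B. \<forall>(x, u)\<in>D k. NW x \<le> B" for k by (rule exI[of _ "real k"]) (auto simp: D_def)
    show "(x', u') \<in> D k" if "\<And>n. (x n, u n) \<in> D k" "x' \<in> W" "u' \<in> K"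
      "(\<lambda>n. NW (x n - x')) \<longlonglongrightarrow> 0" "(\<lambda>n. NV (u n - u')) \<longlonglongrightarrow> 0" for k x u x' u'
      by (rule closed_D[OF that(1,2) subsetD[OF K_subset that(3)] that(4,5)])
    show "\<exists>\<alpha>>0. \<exists>k x v. (x, v) \<in> D k \<and> u = \<alpha> *\<^sub>R v" if "u \<in> K" for u
    proof -
      from that obtain \<alpha> v where "0 < \<alpha>" "v \<in> V" "\<phi> v < \<infinity>" "u = \<alpha> *\<^sub>R v" unfolding K_def by blast
      moreover from this obtain k x where "(x, v) \<in> D k" using value_finite_obtain_D by blast
      ultimately show ?thesis by blast
    qed
  qed blast
  then obtain k r where r: "0 < r" and k: "\<And>u. u \<in> K \<Longrightarrow> NV u < r \<Longrightarrow> \<exists>x. (x, u) \<in> D k" by blast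
  show thesis
    by (rule that[OF r, of "real (Suc T) * real k + real k"]) (use k value_le_on_D in blast)
qed

lemma value_convex: "convex_on_subspace V \<phi>"
  unfolding convex_on_subspace_def
proof (intro ballI allI impI)
  fix u v a b and s :: real
  assume u: "u \<in> V" and v: "v \<in> V" and a: "\<phi> u < ereal a" and b: "\<phi> v < ereal b" and s: "0 < s" "s < 1"
  obtain x where x: "x \<in> W" "F x u < ereal a" using a unfolding \<phi>_def INF_less_iff by blast
  obtain y where y: "y \<in> W" "F y v < ereal b" using b unfolding \<phi>_def INF_less_iff by blast
  have "F x u < \<infinity>" "F y v < \<infinity>" using x(2) y(2) by auto
  obtain g h where g: "\<And>t. t \<le> T \<Longrightarrow> G t (x t) = ereal (g t)" and h: "H (u - A x) = ereal h"
    and Fx: "F x u = ereal ((\<Sum>t\<le>T. g t) + h)" using F_real[OF x(1) u \<open>F x u < \<infinity>\<close>] by blast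
  obtain g' h' where g': "\<And>t. t \<le> T \<Longrightarrow> G t (y t) = ereal (g' t)" and h': "H (v - A y) = ereal h'"
    and Fy: "F y v = ereal ((\<Sum>t\<le>T. g' t) + h')" using F_real[OF y(1) v \<open>F y v < \<infinity>\<close>] by blast
  let ?x = "s *\<^sub>R x + (1 - s) *\<^sub>R y" and ?u = "s *\<^sub>R u + (1 - s) *\<^sub>R v"
  have xW: "?x \<in> W" by (intro W.add_mem W.scale_mem x y)
  have "G t (?x t) \<le> ereal (s * g t + (1 - s) * g' t)" if t: "t \<le> T" for t
    using convex_funD[OF G_convex[OF t], of "x t" "g t" "y t" "g' t" s "?x t"] x(1) y(1) g[OF t] g'[OF t] t s
    by (simp add: W_def)
  then have "(\<Sum>t\<le>T. G t (?x t)) \<le> (\<Sum>t\<le>T. ereal (s * g t + (1 - s) * g' t))"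
    by (intro sum_mono) simp
  moreover have "H (?u - A ?x) \<le> ereal (s * h + (1 - s) * h')"
  proof -
    have "?u - A ?x = s *\<^sub>R (u - A x) + (1 - s) *\<^sub>R (v - A y)"
      unfolding A_add A_scale by (simp add: scaleR_diff_right)
    then show ?thesis
      using V.diff_mem[OF u A_mem[OF x(1)]] V.diff_mem[OF v A_mem[OF y(1)]] h h' s
      by (intro convex_funD[where f = H and x = "u - A x" and y = "v - A y", OF H_convex]) simp_all
  qed
  ultimately have "F ?x ?u \<le> (\<Sum>t\<le>T. ereal (s * g t + (1 - s) * g' t)) + ereal (s * h + (1 - s) * h')"
    unfolding F_def by (rule add_mono)
  also have "\<dots> = ereal (s * ((\<Sum>t\<le>T. g t) + h) + (1 - s) * ((\<Sum>t\<le>T. g' t) + h'))"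
    by (simp add: sum.distrib sum_distrib_left distrib_left)
  also have "\<dots> < ereal (s * a + (1 - s) * b)"
    using x(2) y(2) Fx Fy s by (simp add: add_strict_mono)
  finally have "F ?x ?u < ereal (s * a + (1 - s) * b)" .
  moreover have "\<phi> ?u \<le> F ?x ?u" unfolding \<phi>_def by (rule INF_lower[OF xW])
  ultimately show "\<phi> ?u < ereal (s * a + (1 - s) * b)" by (rule le_less_trans[rotated])
qed

lemma subgradient_exists:
  assumes c: "\<phi> 0 = ereal c"
  obtains l where "l \<in> weighted_dual (path_top T X) (path_weight T \<psi>)"
    "\<And>u. u \<in> V \<Longrightarrow> ereal (c + l u) \<le> \<phi> u"
proof -
  obtain B r where r: "0 < r" and B: "\<And>u. u \<in> K \<Longrightarrow> NV u < r \<Longrightarrow> \<phi> u \<le> ereal B"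
    using value_bounded_near_zero by blast
  have "\<phi> (- (t *\<^sub>R w)) < ereal (B + 1)" if "w \<in> V" "\<phi> w < \<infinity>" "0 < t" "NV (t *\<^sub>R w) < r" for w t
  proof -
    have "- (t *\<^sub>R w) \<in> K"
      using dom_subset_K that by (intro subspace_neg subspace_scale subspace_K)
    then have "\<phi> (- (t *\<^sub>R w)) \<le> ereal B"
      using B V.N_neg[OF V.scale_mem[OF that(1)], of t] that(4) by simp
    then show ?thesis by (rule le_less_trans) simp
  qed
  from V.subgradient_at_zero[OF value_convex c r this]
  obtain l M where l: "linear_on V l" "\<And>u. u \<in> V \<Longrightarrow> l u \<le> M * NV u"
    "\<And>u. u \<in> V \<Longrightarrow> ereal (c + l u) \<le> \<phi> u" by blast
  from bounded_linear_on_in_weighted_dual[OF weightV l(1,2)] l(3) show thesis by (rule that)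
qed

text \<open>
  If the primal value is \<open>-\<infinity>\<close>, then every dual element has the value \<open>\<infinity>\<close>, and 0 attains it.
\<close>

lemma dual_attained:
  "\<exists>l\<in>weighted_dual (path_top T X) (path_weight T \<psi>). dual_obj T X \<psi> G H l \<le> - \<phi> 0"
proof (cases "\<phi> 0")
  case (real c)
  obtain l where l: "l \<in> weighted_dual (path_top T X) (path_weight T \<psi>)"
    "\<And>u. u \<in> V \<Longrightarrow> ereal (c + l u) \<le> \<phi> u" using subgradient_exists[OF real] by blast
  then have "dual_obj T X \<psi> G H l \<le> - \<phi> 0"
    using dual_obj_le_of_subgradient[of l c] real by (simp add: weighted_dual_iff)
  with l(1) show ?thesis by blast
next
  case PInf
  then show ?thesis using value_zero_less by simp
next
  case MInf
  have "(\<lambda>_. 0) \<in> weighted_dual (path_top T X) (path_weight T \<psi>)"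
    by (rule bounded_linear_on_in_weighted_dual[OF weightV, of _ 0]) (simp_all add: linear_on_def)
  then show ?thesis using MInf by (intro bexI) auto
qed

end

theorem theorem2:
  fixes T :: nat
    and X :: "nat \<Rightarrow> 'a topology"
    and \<psi> :: "nat \<Rightarrow> 'a \<Rightarrow> real"
    and G :: "nat \<Rightarrow> ('a \<Rightarrow> real^'d) \<Rightarrow> ereal"
    and H :: "((nat \<Rightarrow> 'a) \<Rightarrow> real^'d) \<Rightarrow> ereal"
  assumes "\<And>t. t \<le> T \<Longrightarrow> polish_topology (X t)"
    and "\<And>t. t \<le> T \<Longrightarrow> continuous_map (X t) euclideanreal (\<psi> t)"
    and "\<And>t s. t \<le> T \<Longrightarrow> s \<in> topspace (X t) \<Longrightarrow> 1 \<le> \<psi> t s"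
    and "\<And>t. t \<le> T \<Longrightarrow> proper_fun (X t) (\<psi> t) (G t)"
    and "\<And>t. t \<le> T \<Longrightarrow> convex_fun (X t) (\<psi> t) (G t)"
    and "\<And>t. t \<le> T \<Longrightarrow> lsc_fun (X t) (\<psi> t) (G t)"
    and "proper_fun (path_top T X) (path_weight T \<psi>) H"
    and "convex_fun (path_top T X) (path_weight T \<psi>) H"
    and "lsc_fun (path_top T X) (path_weight T \<psi>) H"
    and "closed_linear_subspace (path_top T X) (path_weight T \<psi>)
           (\<Union>\<alpha>\<in>{0::real<..}. (\<lambda>u s. \<alpha> *\<^sub>R u s) ` dom_value_fun T X \<psi> G H)"
  shows "(\<exists>l \<in> weighted_dual (path_top T X) (path_weight T \<psi>).
            dual_obj T X \<psi> G H l = dual_inf T X \<psi> G H) \<and>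
         primal_inf T X \<psi> G H = - dual_inf T X \<psi> G H \<and>
         (\<forall>x \<in> prod_space T X \<psi>.
            (solves_primal T X \<psi> G H x \<longleftrightarrow>
               (\<exists>l \<in> weighted_dual (path_top T X) (path_weight T \<psi>).
                  optimality_conditions T X \<psi> G H x l)) \<and>
            (\<forall>l \<in> weighted_dual (path_top T X) (path_weight T \<psi>).
               optimality_conditions T X \<psi> G H x l \<longrightarrow> solves_dual T X \<psi> G H l))"
proof -
  interpret stable_primal_dual_setting T X \<psi> G H
    by unfold_locales (use assms in \<open>simp_all add: weight_def\<close>)
  let ?L = "weighted_dual (path_top T X) (path_weight T \<psi>) :: (((nat \<Rightarrow> 'a) \<Rightarrow> real^'d) \<Rightarrow> real) set"
  have weak: "- \<phi> 0 \<le> dual_inf T X \<psi> G H"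
    unfolding dual_inf_def by (intro INF_greatest weak_duality)
  obtain l where l: "l \<in> ?L" "dual_obj T X \<psi> G H l \<le> - \<phi> 0" using dual_attained by blast
  have "dual_inf T X \<psi> G H \<le> dual_obj T X \<psi> G H l"
    unfolding dual_inf_def by (rule INF_lower[OF l(1)])
  with weak l(2) have dual: "dual_inf T X \<psi> G H = - \<phi> 0" and dual_l: "dual_obj T X \<psi> G H l = dual_inf T X \<psi> G H"
    by (auto intro: antisym order_trans)
  have gap: "primal_inf T X \<psi> G H = - dual_inf T X \<psi> G H"
    unfolding primal_inf_eq dual by simp
  have sol: "solves_primal T X \<psi> G H x \<longleftrightarrow> F x 0 = \<phi> 0" if "x \<in> prod_space T X \<psi>" for x
    using that by (simp add: solves_primal_def primal_obj_eq primal_inf_eq)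
  have suff: "solves_primal T X \<psi> G H x \<and> solves_dual T X \<psi> G H k"
    if "x \<in> prod_space T X \<psi>" "k \<in> ?L" "optimality_conditions T X \<psi> G H x k" for x k
    using optimality_conditions_imp_optimal[OF that(2) prod_space_sub[OF that(1)] that(3)] sol[OF that(1)] that(2)
    by (simp add: solves_dual_def dual)
  have nec: "\<exists>k\<in>?L. optimality_conditions T X \<psi> G H x k"
    if x: "x \<in> prod_space T X \<psi>" and opt: "solves_primal T X \<psi> G H x" for x
  proof -
    have xW: "x \<in> W" by (rule prod_space_sub[OF x])
    have Fx: "F x 0 = \<phi> 0" using opt sol[OF x] by simp
    obtain c where c: "\<phi> 0 = ereal c"
      using F_not_MInf[OF xW V.zero_mem] value_zero_less Fx by (cases "\<phi> 0") auto
    obtain k where "k \<in> ?L" "\<And>u. u \<in> V \<Longrightarrow> ereal (c + k u) \<le> \<phi> u"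
      using subgradient_exists[OF c] by blast
    then show ?thesis using subgradient_imp_optimality_conditions[of k c x] xW Fx c by auto
  qed
  show ?thesis using l(1) dual_l gap suff nec by blast
qed

end
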